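(* There exists no proper biharmonic constant mean curvature hypersurface with $\xi$ tangent to it in a generalized Sasakian space form $\widetilde{M}(f_1,f_2,f_3)$ (of dimension $n+1$) if the functions $f_1,f_2,f_3$ satisfy $nf_1-f_2+3f_3\leqslant 0$. In particular, there exists no proper biharmonic constant mean curvature hypersurface with $\xi$ tangent in - a Sasakian space form $\widetilde{M}^{n+1}_S(c)$ if $c\leqslant-\frac{3n-2}{n+2}$, - a Kenmotsu space form $\widetilde{M}^{n+1}_K(c)$ if $c\leqslant\frac{3n-2}{n+2}$, - a cosymplectic space form $\widetilde{M}^{n+1}_C(c)$ if $c\leqslant0$.
   Context: An almost contact metric manifold $(\widetilde M,\widetilde g,\xi,\eta,\phi)$ is an odd-dimensional Riemannian manifold with a vector field $\xi$, a 1-form $\eta$ and a $(1,1)$-tensor $\phi$ such that $\eta(\xi)=1$, $\phi^2=-\mathrm{Id}+\eta\otimes\xi$, $\widetilde g(\phi X,\phi Y)=\widetilde g(X,Y)-\eta(X)\eta(Y)$, $\eta(X)=\widetilde g(X,\xi)$. Set $\Omega(X,Y)=\widetilde g(X,\phi Y)$. A generalized Sasakian space form $\widetilde M(f_1,f_2,f_3)$ is an almost contact metric manifold whose curvature tensor is $f_1R_1^\star+f_2R_2^\star+f_3R_3^\star$, where $f_1,f_2,f_3$ are real functions on $\widetilde M$ and $$R_1^{\star}(X,Y)Z=\widetilde g(Y,Z)X-\widetilde g(X,Z)Y,$$ $$R_2^{\star}(X,Y)Z=\eta(X)\eta(Z)Y-\eta(Y)\eta(Z)X+\widetilde g(X,Z)\eta(Y)\xi-\widetilde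 g(Y,Z)\eta(X)\xi,$$ $$R_3^{\star}(X,Y)Z=\Omega(Z,Y)\phi X-\Omega(Z,X)\phi Y+2\Omega(X,Y)\phi Z.$$ Curvature convention: $R(X,Y)=[\nabla_X,\nabla_Y]-\nabla_{[X,Y]}$. An almost contact metric manifold is Sasakian if $(\nabla_X\phi)Y=\widetilde g(X,Y)\xi-\eta(Y)X$, Kenmotsu if $(\nabla_X\phi)Y=-\eta(Y)\phi X-\widetilde g(X,\phi Y)\xi$, cosymplectic if $\nabla\phi=0$. The $\phi$-sectional curvature is the sectional curvature of planes spanned by $X,\phi X$ ($X\perp\xi$). $\widetilde M^{n+1}_S(c)$, $\widetilde M^{n+1}_K(c)$, $\widetilde M^{n+1}_C(c)$ denote respectively a Sasakian, Kenmotsu, cosymplectic manifold of dimension $n+1$ with constant $\phi$-sectional curvature $c$; their curvature tensors have the form $f_1R_1^\star+f_2R_2^\star+f_3R_3^\star$ with, respectively, $f_1=\frac{c+3}{4},\ f_2=f_3=\frac{c-1}{4}$; $f_1=\frac{c-3}{4},\ f_2=f_3=\frac{c+1}{4}$; $f_1=f_2=f_3=\frac c4$. Constant mean curvature means that the length of the mean curvature vector field is constant. A submanifold given by an isometric immersion $\psi:M\to\widetilde M$ is biharmonic if $\tau_2(\psi)=0$, where $\tau_2(\psi)=\Delta\tau(\psi)-\mathrm{tr}\big(R^{\widetilde M}(d\psi,\tau(\psi))d\psi\big)$, $\tau(\psi)$ is the tension field and $\Delta V=\mathrm{tr}(\nabla^2V)$ is the rough Laplacian on sections of $\psi^{-1}(T\widetilde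 M)$. It is proper biharmonic if it is biharmonic and not harmonic (i.e. not minimal). *)

theory Defs
  imports "HOL-Analysis.Analysis"
begin

section \<open>Smooth maps between open subsets of Euclidean spaces\<close>

text \<open>Intended for open \<open>S\<close>: all iterated directional derivatives exist and are continuous on \<open>S\<close>.\<close>

primrec Ck_on :: "nat \<Rightarrow> 'a::euclidean_space set \<Rightarrow> ('a \<Rightarrow> 'b::real_normed_vector) \<Rightarrow> bool" where
  "Ck_on 0 S f \<longleftrightarrow> continuous_on S f"
| "Ck_on (Suc k) S f \<longleftrightarrow> (\<forall>x\<in>S. f differentiable (at x)) \<and>
     (\<forall>v. Ck_on k S (\<lambda>x. frechet_derivative f (at x) v))"

definition smooth_on :: "'a::euclidean_space set \<Rightarrow> ('a \<Rightarrow> 'b::real_normed_vector) \<Rightarrow> bool" where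
  "smooth_on S f \<longleftrightarrow> (\<forall>k. Ck_on k S f)"

section \<open>Riemannian geometry in a coordinate domain\<close>

text \<open>In this section \<open>G\<close> is the matrix field \<open>(g\<^sub>i\<^sub>j)\<close> of a metric in a coordinate domain; vector fields
  are given by their component functions.\<close>

definition inner_mat :: "real^'m^'m \<Rightarrow> real^'m \<Rightarrow> real^'m \<Rightarrow> real" where
  "inner_mat A u v = u \<bullet> (A *v v)"

text \<open>\<open>christoffel G x u v\<close> has components \<open>\<Gamma>\<^sup>k\<^sub>i\<^sub>j u\<^sup>i v\<^sup>j\<close>, where
  \<open>\<Gamma>\<^sup>k\<^sub>i\<^sub>j = 1/2 g\<^sup>k\<^sup>l (\<partial>\<^sub>i g\<^sub>j\<^sub>l + \<partial>\<^sub>j g\<^sub>i\<^sub>l - \<partial>\<^sub>l g\<^sub>i\<^sub>j)\<close>.\<close>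

definition christoffel :: "(real^'m \<Rightarrow> real^'m^'m) \<Rightarrow> real^'m \<Rightarrow> real^'m \<Rightarrow> real^'m \<Rightarrow> real^'m" where
  "christoffel G x u v = matrix_inv (G x) *v (\<chi> l.
     (frechet_derivative (\<lambda>y. inner_mat (G y) v (axis l 1)) (at x) u
    + frechet_derivative (\<lambda>y. inner_mat (G y) u (axis l 1)) (at x) v
    - frechet_derivative (\<lambda>y. inner_mat (G y) u v) (at x) (axis l 1)) / 2)"

definition cov_deriv :: "(real^'m \<Rightarrow> real^'m^'m) \<Rightarrow> (real^'m \<Rightarrow> real^'m) \<Rightarrow> (real^'m \<Rightarrow> real^'m)
    \<Rightarrow> real^'m \<Rightarrow> real^'m" where
  "cov_deriv G X Y x = frechet_derivative Y (at x) (X x) + christoffel G x (X x) (Y x)"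

definition lie_bracket :: "(real^'m \<Rightarrow> real^'m) \<Rightarrow> (real^'m \<Rightarrow> real^'m) \<Rightarrow> real^'m \<Rightarrow> real^'m" where
  "lie_bracket X Y x = frechet_derivative Y (at x) (X x) - frechet_derivative X (at x) (Y x)"

definition curvature_op :: "(real^'m \<Rightarrow> real^'m^'m) \<Rightarrow> (real^'m \<Rightarrow> real^'m) \<Rightarrow> (real^'m \<Rightarrow> real^'m)
    \<Rightarrow> (real^'m \<Rightarrow> real^'m) \<Rightarrow> real^'m \<Rightarrow> real^'m" where
  "curvature_op G X Y Z x =
     cov_deriv G X (cov_deriv G Y Z) x - cov_deriv G Y (cov_deriv G X Z) x
     - cov_deriv G (lie_bracket X Y) Z x"

text \<open>The curvature is tensorial, so its value on the tangent vectors \<open>u, v, w\<close> at \<open>x\<close> can be computed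
  with any local extensions; we take those with constant components. The same remark applies to
  \<open>\<nabla>\<phi>\<close> and to the second derivatives along a map below.\<close>

definition riem :: "(real^'m \<Rightarrow> real^'m^'m) \<Rightarrow> real^'m \<Rightarrow> real^'m \<Rightarrow> real^'m \<Rightarrow> real^'m \<Rightarrow> real^'m" where
  "riem G x u v w = curvature_op G (\<lambda>_. u) (\<lambda>_. v) (\<lambda>_. w) x"

definition sectional_curv :: "(real^'m \<Rightarrow> real^'m^'m) \<Rightarrow> real^'m \<Rightarrow> real^'m \<Rightarrow> real^'m \<Rightarrow> real" where
  "sectional_curv G x u v = inner_mat (G x) (riem G x u v v) u /
     (inner_mat (G x) u u * inner_mat (G x) v v - (inner_mat (G x) u v)\<^sup>2)"

text \<open>\<open>(\<nabla>\<^sub>u \<phi>) v = \<nabla>\<^sub>u (\<phi> v) - \<phi> (\<nabla>\<^sub>u v)\<close> for a (1,1)-tensor field given by its matrix field \<open>P\<close>.\<close>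

definition cov_deriv_endo :: "(real^'m \<Rightarrow> real^'m^'m) \<Rightarrow> (real^'m \<Rightarrow> real^'m^'m)
    \<Rightarrow> real^'m \<Rightarrow> real^'m \<Rightarrow> real^'m \<Rightarrow> real^'m" where
  "cov_deriv_endo G P x u v =
     cov_deriv G (\<lambda>_. u) (\<lambda>y. P y *v v) x - P x *v cov_deriv G (\<lambda>_. u) (\<lambda>_. v) x"

subsection \<open>Maps between Riemannian manifolds in coordinates\<close>

text \<open>\<open>G\<close> is the metric of the source, \<open>H\<close> that of the target, \<open>F\<close> the coordinate representation of
  the map, \<open>V\<close> a section of the pull-back of the tangent bundle of the target.\<close>

definition metric_trace :: "real^'n^'n \<Rightarrow> (real^'n \<Rightarrow> real^'n \<Rightarrow> 'b::real_vector) \<Rightarrow> 'b" where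
  "metric_trace A b = (\<Sum>i\<in>UNIV. \<Sum>j\<in>UNIV. (matrix_inv A $ i $ j) *\<^sub>R b (axis i 1) (axis j 1))"

definition pullback_cov :: "(real^'m \<Rightarrow> real^'m^'m) \<Rightarrow> (real^'n \<Rightarrow> real^'m) \<Rightarrow> (real^'n \<Rightarrow> real^'m)
    \<Rightarrow> real^'n \<Rightarrow> real^'n \<Rightarrow> real^'m" where
  "pullback_cov H F V x u = frechet_derivative V (at x) u
     + christoffel H (F x) (frechet_derivative F (at x) u) (V x)"

text \<open>\<open>(\<nabla>dF)(u,v) = \<nabla>\<^sub>u (dF v) - dF (\<nabla>\<^sub>u v)\<close>; by the Gauss formula this is the usual (normal-bundle
  valued) second fundamental form if \<open>F\<close> is an isometric immersion.\<close>

definition second_ff :: "(real^'n \<Rightarrow> real^'n^'n) \<Rightarrow> (real^'m \<Rightarrow> real^'m^'m) \<Rightarrow> (real^'n \<Rightarrow> real^'m)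
    \<Rightarrow> real^'n \<Rightarrow> real^'n \<Rightarrow> real^'n \<Rightarrow> real^'m" where
  "second_ff G H F x u v = pullback_cov H F (\<lambda>y. frechet_derivative F (at y) v) x u
     - frechet_derivative F (at x) (cov_deriv G (\<lambda>_. u) (\<lambda>_. v) x)"

definition tension :: "(real^'n \<Rightarrow> real^'n^'n) \<Rightarrow> (real^'m \<Rightarrow> real^'m^'m) \<Rightarrow> (real^'n \<Rightarrow> real^'m)
    \<Rightarrow> real^'n \<Rightarrow> real^'m" where
  "tension G H F x = metric_trace (G x) (second_ff G H F x)"

definition mean_curv :: "(real^'n \<Rightarrow> real^'n^'n) \<Rightarrow> (real^'m \<Rightarrow> real^'m^'m) \<Rightarrow> (real^'n \<Rightarrow> real^'m)
    \<Rightarrow> real^'n \<Rightarrow> real^'m" where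
  "mean_curv G H F x = (1 / real CARD('n)) *\<^sub>R metric_trace (G x) (second_ff G H F x)"

text \<open>\<open>(\<nabla>\<^sup>2V)(u,v) = \<nabla>\<^sub>u (\<nabla>\<^sub>v V) - \<nabla>\<^bsub>\<nabla>\<^sub>u v\<^esub> V\<close>\<close>

definition second_cov :: "(real^'n \<Rightarrow> real^'n^'n) \<Rightarrow> (real^'m \<Rightarrow> real^'m^'m) \<Rightarrow> (real^'n \<Rightarrow> real^'m)
    \<Rightarrow> (real^'n \<Rightarrow> real^'m) \<Rightarrow> real^'n \<Rightarrow> real^'n \<Rightarrow> real^'n \<Rightarrow> real^'m" where
  "second_cov G H F V x u v = pullback_cov H F (\<lambda>y. pullback_cov H F V y v) x u
     - pullback_cov H F V x (cov_deriv G (\<lambda>_. u) (\<lambda>_. v) x)"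

definition rough_laplacian :: "(real^'n \<Rightarrow> real^'n^'n) \<Rightarrow> (real^'m \<Rightarrow> real^'m^'m)
    \<Rightarrow> (real^'n \<Rightarrow> real^'m) \<Rightarrow> (real^'n \<Rightarrow> real^'m) \<Rightarrow> real^'n \<Rightarrow> real^'m" where
  "rough_laplacian G H F V x = metric_trace (G x) (second_cov G H F V x)"

definition bitension :: "(real^'n \<Rightarrow> real^'n^'n) \<Rightarrow> (real^'m \<Rightarrow> real^'m^'m) \<Rightarrow> (real^'n \<Rightarrow> real^'m)
    \<Rightarrow> real^'n \<Rightarrow> real^'m" where
  "bitension G H F x = rough_laplacian G H F (tension G H F) x
     - metric_trace (G x) (\<lambda>u v. riem H (F x) (frechet_derivative F (at x) u) (tension G H F x)
         (frechet_derivative F (at x) v))"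

section \<open>Smooth and Riemannian manifolds\<close>

text \<open>A chart is a pair of a domain and a coordinate map. Tensor fields are given classically, by
  their component functions in every chart of the atlas, subject to the transformation law.\<close>

type_synonym ('a, 'n) chart = "'a set \<times> ('a \<Rightarrow> real^'n)"

record ('a, 'n::finite) manifold =
  mfd_top :: "'a topology"
  atlas :: "('a, 'n) chart set"

definition chart_image :: "('a, 'n::finite) chart \<Rightarrow> (real^'n) set" where
  "chart_image C = snd C ` fst C"

definition chart_inv :: "('a, 'n::finite) chart \<Rightarrow> real^'n \<Rightarrow> 'a" where
  "chart_inv C = inv_into (fst C) (snd C)"

definition coord_rep :: "('a, 'n::finite) chart \<Rightarrow> ('b, 'm::finite) chart \<Rightarrow> ('a \<Rightarrow> 'b) \<Rightarrow> real^'n \<Rightarrow> real^'m"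
  where "coord_rep C D \<psi> = snd D \<circ> \<psi> \<circ> chart_inv C"

definition trans_deriv :: "('a, 'n::finite) chart \<Rightarrow> ('a, 'n) chart \<Rightarrow> 'a \<Rightarrow> real^'n \<Rightarrow> real^'n" where
  "trans_deriv C D p = frechet_derivative (coord_rep C D id) (at (snd C p))"

definition smooth_manifold :: "('a, 'n::finite, 'z) manifold_scheme \<Rightarrow> bool" where
  "smooth_manifold M \<longleftrightarrow>
     Hausdorff_space (mfd_top M) \<and> second_countable (mfd_top M) \<and>
     (\<Union>C\<in>atlas M. fst C) = topspace (mfd_top M) \<and>
     (\<forall>C\<in>atlas M. openin (mfd_top M) (fst C) \<and> open (chart_image C) \<and>
        homeomorphic_map (subtopology (mfd_top M) (fst C)) (top_of_set (chart_image C)) (snd C)) \<and>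
     (\<forall>C\<in>atlas M. \<forall>D\<in>atlas M. smooth_on (snd C ` (fst C \<inter> fst D)) (coord_rep C D id))"

record ('a, 'n::finite) riemannian = "('a, 'n) manifold" +
  metric :: "('a, 'n) chart \<Rightarrow> real^'n \<Rightarrow> real^'n^'n"

definition riemannian_manifold :: "('a, 'n::finite, 'z) riemannian_scheme \<Rightarrow> bool" where
  "riemannian_manifold M \<longleftrightarrow> smooth_manifold M \<and>
     (\<forall>C\<in>atlas M. smooth_on (chart_image C) (metric M C) \<and>
        (\<forall>x\<in>chart_image C. transpose (metric M C x) = metric M C x \<and>
           (\<forall>u. u \<noteq> 0 \<longrightarrow> inner_mat (metric M C x) u u > 0))) \<and>
     (\<forall>C\<in>atlas M. \<forall>D\<in>atlas M. \<forall>p\<in>fst C \<inter> fst D. \<forall>u v.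
        inner_mat (metric M D (snd D p)) (trans_deriv C D p u) (trans_deriv C D p v)
        = inner_mat (metric M C (snd C p)) u v)"

section \<open>Almost contact metric manifolds\<close>

text \<open>In a chart, the 1-form \<open>\<eta>\<close> acts by \<open>\<eta>(u) = \<eta> \<bullet> u\<close> and the (1,1)-tensor \<open>\<phi>\<close> by
  \<open>\<phi> u = \<phi> *v u\<close>.\<close>

record ('a, 'm::finite) contact_metric = "('a, 'm) riemannian" +
  xi :: "('a, 'm) chart \<Rightarrow> real^'m \<Rightarrow> real^'m"
  eta :: "('a, 'm) chart \<Rightarrow> real^'m \<Rightarrow> real^'m"
  phi :: "('a, 'm) chart \<Rightarrow> real^'m \<Rightarrow> real^'m^'m"

definition almost_contact_metric_manifold :: "('a, 'm::finite, 'z) contact_metric_scheme \<Rightarrow> bool" where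
  "almost_contact_metric_manifold N \<longleftrightarrow> riemannian_manifold N \<and> odd CARD('m) \<and>
     (\<forall>C\<in>atlas N. smooth_on (chart_image C) (xi N C) \<and> smooth_on (chart_image C) (eta N C) \<and>
        smooth_on (chart_image C) (phi N C)) \<and>
     (\<forall>C\<in>atlas N. \<forall>D\<in>atlas N. \<forall>p\<in>fst C \<inter> fst D.
        xi N D (snd D p) = trans_deriv C D p (xi N C (snd C p)) \<and>
        (\<forall>u. eta N D (snd D p) \<bullet> trans_deriv C D p u = eta N C (snd C p) \<bullet> u) \<and>
        (\<forall>u. phi N D (snd D p) *v trans_deriv C D p u = trans_deriv C D p (phi N C (snd C p) *v u))) \<and>
     (\<forall>C\<in>atlas N. \<forall>x\<in>chart_image C.
        let g = inner_mat (metric N C x); \<xi> = xi N C x; \<eta> = (\<lambda>u. eta N C x \<bullet> u);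
            \<phi> = (\<lambda>u. phi N C x *v u)
        in \<eta> \<xi> = 1 \<and> (\<forall>u. \<phi> (\<phi> u) = - u + \<eta> u *\<^sub>R \<xi>) \<and>
           (\<forall>u v. g (\<phi> u) (\<phi> v) = g u v - \<eta> u * \<eta> v) \<and> (\<forall>u. \<eta> u = g u \<xi>))"

definition R1star :: "('v \<Rightarrow> 'v \<Rightarrow> real) \<Rightarrow> 'v::real_vector \<Rightarrow> 'v \<Rightarrow> 'v \<Rightarrow> 'v" where
  "R1star g X Y Z = g Y Z *\<^sub>R X - g X Z *\<^sub>R Y"

definition R2star :: "('v \<Rightarrow> 'v \<Rightarrow> real) \<Rightarrow> 'v \<Rightarrow> ('v \<Rightarrow> real) \<Rightarrow> 'v::real_vector \<Rightarrow> 'v \<Rightarrow> 'v \<Rightarrow> 'v" where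
  "R2star g \<xi> \<eta> X Y Z = (\<eta> X * \<eta> Z) *\<^sub>R Y - (\<eta> Y * \<eta> Z) *\<^sub>R X
     + (g X Z * \<eta> Y) *\<^sub>R \<xi> - (g Y Z * \<eta> X) *\<^sub>R \<xi>"

definition R3star :: "('v \<Rightarrow> 'v \<Rightarrow> real) \<Rightarrow> ('v \<Rightarrow> 'v) \<Rightarrow> 'v::real_vector \<Rightarrow> 'v \<Rightarrow> 'v \<Rightarrow> 'v" where
  "R3star g \<phi> X Y Z = (let \<Omega> = (\<lambda>X Y. g X (\<phi> Y))
     in \<Omega> Z Y *\<^sub>R \<phi> X - \<Omega> Z X *\<^sub>R \<phi> Y + (2 * \<Omega> X Y) *\<^sub>R \<phi> Z)"

definition generalized_sasakian_space_form ::
  "('b, 'm::finite, 'z) contact_metric_scheme \<Rightarrow> ('b \<Rightarrow> real) \<Rightarrow> ('b \<Rightarrow> real) \<Rightarrow> ('b \<Rightarrow> real) \<Rightarrow> bool" where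
  "generalized_sasakian_space_form N f1 f2 f3 \<longleftrightarrow> almost_contact_metric_manifold N \<and>
     (\<forall>C\<in>atlas N. \<forall>p\<in>fst C. \<forall>X Y Z.
        let x = snd C p; g = inner_mat (metric N C x); \<xi> = xi N C x; \<eta> = (\<lambda>u. eta N C x \<bullet> u);
            \<phi> = (\<lambda>u. phi N C x *v u)
        in riem (metric N C) x X Y Z = f1 p *\<^sub>R R1star g X Y Z + f2 p *\<^sub>R R2star g \<xi> \<eta> X Y Z
             + f3 p *\<^sub>R R3star g \<phi> X Y Z)"

definition sasakian :: "('b, 'm::finite, 'z) contact_metric_scheme \<Rightarrow> bool" where
  "sasakian N \<longleftrightarrow> almost_contact_metric_manifold N \<and>
     (\<forall>C\<in>atlas N. \<forall>x\<in>chart_image C. \<forall>X Y.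
        cov_deriv_endo (metric N C) (phi N C) x X Y
        = inner_mat (metric N C x) X Y *\<^sub>R xi N C x - (eta N C x \<bullet> Y) *\<^sub>R X)"

definition kenmotsu :: "('b, 'm::finite, 'z) contact_metric_scheme \<Rightarrow> bool" where
  "kenmotsu N \<longleftrightarrow> almost_contact_metric_manifold N \<and>
     (\<forall>C\<in>atlas N. \<forall>x\<in>chart_image C. \<forall>X Y.
        cov_deriv_endo (metric N C) (phi N C) x X Y
        = - ((eta N C x \<bullet> Y) *\<^sub>R (phi N C x *v X))
          - inner_mat (metric N C x) X (phi N C x *v Y) *\<^sub>R xi N C x)"

definition cosymplectic :: "('b, 'm::finite, 'z) contact_metric_scheme \<Rightarrow> bool" where
  "cosymplectic N \<longleftrightarrow> almost_contact_metric_manifold N \<and>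
     (\<forall>C\<in>atlas N. \<forall>x\<in>chart_image C. \<forall>X Y. cov_deriv_endo (metric N C) (phi N C) x X Y = 0)"

definition constant_phi_sectional_curvature ::
  "('b, 'm::finite, 'z) contact_metric_scheme \<Rightarrow> real \<Rightarrow> bool" where
  "constant_phi_sectional_curvature N c \<longleftrightarrow>
     (\<forall>C\<in>atlas N. \<forall>x\<in>chart_image C. \<forall>X. X \<noteq> 0 \<and> inner_mat (metric N C x) X (xi N C x) = 0 \<longrightarrow>
        sectional_curv (metric N C) x X (phi N C x *v X) = c)"

definition sasakian_space_form :: "('b, 'm::finite, 'z) contact_metric_scheme \<Rightarrow> real \<Rightarrow> bool" where
  "sasakian_space_form N c \<longleftrightarrow> sasakian N \<and> constant_phi_sectional_curvature N c"

definition kenmotsu_space_form :: "('b, 'm::finite, 'z) contact_metric_scheme \<Rightarrow> real \<Rightarrow> bool" where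
  "kenmotsu_space_form N c \<longleftrightarrow> kenmotsu N \<and> constant_phi_sectional_curvature N c"

definition cosymplectic_space_form :: "('b, 'm::finite, 'z) contact_metric_scheme \<Rightarrow> real \<Rightarrow> bool" where
  "cosymplectic_space_form N c \<longleftrightarrow> cosymplectic N \<and> constant_phi_sectional_curvature N c"

section \<open>Hypersurfaces\<close>

definition smooth_map :: "('a, 'n::finite, 'y) manifold_scheme \<Rightarrow> ('b, 'm::finite, 'z) manifold_scheme
    \<Rightarrow> ('a \<Rightarrow> 'b) \<Rightarrow> bool" where
  "smooth_map M N \<psi> \<longleftrightarrow> continuous_map (mfd_top M) (mfd_top N) \<psi> \<and>
     (\<forall>C\<in>atlas M. \<forall>D\<in>atlas N. smooth_on (snd C ` (fst C \<inter> \<psi> -` fst D)) (coord_rep C D \<psi>))"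

text \<open>\<open>adapted_charts M N \<psi>\<close> consists of the triples \<open>(C, D, p)\<close> such that \<open>C\<close> is a chart at \<open>p\<close>
  and \<open>D\<close> a chart at \<open>\<psi> p\<close>. All notions below are chart independent; they are required in all charts.\<close>

definition adapted_charts :: "('a, 'n::finite, 'y) manifold_scheme \<Rightarrow> ('b, 'm::finite, 'z) manifold_scheme
    \<Rightarrow> ('a \<Rightarrow> 'b) \<Rightarrow> (('a, 'n) chart \<times> ('b, 'm) chart \<times> 'a) set" where
  "adapted_charts M N \<psi> = {(C, D, p). C \<in> atlas M \<and> D \<in> atlas N \<and> p \<in> fst C \<and> \<psi> p \<in> fst D}"

definition map_deriv :: "('a, 'n::finite) chart \<Rightarrow> ('b, 'm::finite) chart \<Rightarrow> ('a \<Rightarrow> 'b) \<Rightarrow> 'a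
    \<Rightarrow> real^'n \<Rightarrow> real^'m" where
  "map_deriv C D \<psi> p = frechet_derivative (coord_rep C D \<psi>) (at (snd C p))"

definition isometric_immersion :: "('a, 'n::finite, 'y) riemannian_scheme
    \<Rightarrow> ('b, 'm::finite, 'z) riemannian_scheme \<Rightarrow> ('a \<Rightarrow> 'b) \<Rightarrow> bool" where
  "isometric_immersion M N \<psi> \<longleftrightarrow> smooth_map M N \<psi> \<and>
     (\<forall>(C, D, p)\<in>adapted_charts M N \<psi>. inj (map_deriv C D \<psi> p) \<and>
        (\<forall>u v. inner_mat (metric N D (snd D (\<psi> p))) (map_deriv C D \<psi> p u) (map_deriv C D \<psi> p v)
             = inner_mat (metric M C (snd C p)) u v))"

definition hypersurface :: "('a, 'n::finite, 'y) riemannian_scheme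
    \<Rightarrow> ('b, 'm::finite, 'z) riemannian_scheme \<Rightarrow> ('a \<Rightarrow> 'b) \<Rightarrow> bool" where
  "hypersurface M N \<psi> \<longleftrightarrow> riemannian_manifold M \<and> riemannian_manifold N \<and>
     CARD('m) = CARD('n) + 1 \<and> isometric_immersion M N \<psi>"

definition xi_tangent :: "('a, 'n::finite, 'y) riemannian_scheme
    \<Rightarrow> ('b, 'm::finite, 'z) contact_metric_scheme \<Rightarrow> ('a \<Rightarrow> 'b) \<Rightarrow> bool" where
  "xi_tangent M N \<psi> \<longleftrightarrow>
     (\<forall>(C, D, p)\<in>adapted_charts M N \<psi>. xi N D (snd D (\<psi> p)) \<in> range (map_deriv C D \<psi> p))"

definition constant_mean_curvature :: "('a, 'n::finite, 'y) riemannian_scheme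
    \<Rightarrow> ('b, 'm::finite, 'z) riemannian_scheme \<Rightarrow> ('a \<Rightarrow> 'b) \<Rightarrow> bool" where
  "constant_mean_curvature M N \<psi> \<longleftrightarrow> (\<exists>h. \<forall>(C, D, p)\<in>adapted_charts M N \<psi>.
     let H = mean_curv (metric M C) (metric N D) (coord_rep C D \<psi>) (snd C p)
     in sqrt (inner_mat (metric N D (snd D (\<psi> p))) H H) = h)"

definition harmonic_map :: "('a, 'n::finite, 'y) riemannian_scheme
    \<Rightarrow> ('b, 'm::finite, 'z) riemannian_scheme \<Rightarrow> ('a \<Rightarrow> 'b) \<Rightarrow> bool" where
  "harmonic_map M N \<psi> \<longleftrightarrow> (\<forall>(C, D, p)\<in>adapted_charts M N \<psi>.
     tension (metric M C) (metric N D) (coord_rep C D \<psi>) (snd C p) = 0)"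

definition biharmonic_map :: "('a, 'n::finite, 'y) riemannian_scheme
    \<Rightarrow> ('b, 'm::finite, 'z) riemannian_scheme \<Rightarrow> ('a \<Rightarrow> 'b) \<Rightarrow> bool" where
  "biharmonic_map M N \<psi> \<longleftrightarrow> (\<forall>(C, D, p)\<in>adapted_charts M N \<psi>.
     bitension (metric M C) (metric N D) (coord_rep C D \<psi>) (snd C p) = 0)"

definition proper_biharmonic :: "('a, 'n::finite, 'y) riemannian_scheme
    \<Rightarrow> ('b, 'm::finite, 'z) riemannian_scheme \<Rightarrow> ('a \<Rightarrow> 'b) \<Rightarrow> bool" where
  "proper_biharmonic M N \<psi> \<longleftrightarrow> biharmonic_map M N \<psi> \<and> \<not> harmonic_map M N \<psi>"

end

theory Submission
  imports Defs
begin

text \<open>Let \<open>\<tau>\<close> be the tension field of the hypersurface. It is normal, and constant mean curvature says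
  that \<open>|\<tau>|\<close> is constant, so \<open>\<langle>\<Delta>\<tau>, \<tau>\<rangle> = - |\<nabla>\<tau>|\<^sup>2\<close>. The curvature term of the bitension field, paired with
  \<open>\<tau>\<close>, is a Ricci curvature in the normal direction. When \<open>\<xi>\<close> is tangent, \<open>\<tau>\<close> is orthogonal to \<open>\<xi>\<close>, and \<open>\<phi>\<tau>\<close>,
  being orthogonal to \<open>\<tau>\<close>, is tangent because the codimension is one; hence the three model curvature tensors
  contribute \<open>n\<close>, \<open>-1\<close> and \<open>3\<close>, and a biharmonic hypersurface satisfies
  \<open>0 = - |\<nabla>\<tau>|\<^sup>2 + (n f\<^sub>1 - f\<^sub>2 + 3 f\<^sub>3) |\<tau>|\<^sup>2\<close>. If the coefficient is nonpositive, then \<open>\<nabla>\<tau> = 0\<close>. But \<open>\<tau>\<close> is normal, so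
  the tangential part of \<open>\<nabla>\<tau>\<close> is minus the shape operator in the direction \<open>\<tau>\<close>, whose trace is \<open>|\<tau>|\<^sup>2\<close>.
  Therefore \<open>\<tau> = 0\<close>. This is \<open>constant_length_biharmonic_imp_harmonic\<close>, an argument in one pair of charts around
  an arbitrary point.

  The three special cases follow once space forms are known to be generalized Sasakian space forms
  (\<open>trans_sasakian_space_form\<close>). They are treated together: in each of them
  \<open>(\<nabla>\<^sub>X\<phi>)Y = a (\<langle>X,Y\<rangle>\<xi> - \<eta>(Y)X) + b (\<langle>\<phi>X,Y\<rangle>\<xi> - \<eta>(Y)\<phi>X)\<close> with constants \<open>a\<close>, \<open>b\<close> such that \<open>a b = 0\<close>. The Ricci
  identity for \<open>\<phi>\<close> then says that \<open>R - \<kappa> R\<^sub>1\<^sup>\<star>\<close> commutes with \<open>\<phi>\<close>, where \<open>\<kappa> = a\<^sup>2 - b\<^sup>2\<close> (\<open>riem_phi_commutator\<close>). So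
  \<open>R - \<kappa> R\<^sub>1\<^sup>\<star>\<close> has the symmetries of a Kaehler curvature tensor, with \<open>\<xi>\<close> in its kernel, and like such a tensor it is
  determined by its holomorphic sectional curvatures (\<open>kaehler_curvature_eq_0\<close>). These equal \<open>c - \<kappa>\<close>, as do those of
  \<open>(c - \<kappa>)/4 (R\<^sub>1\<^sup>\<star> + R\<^sub>2\<^sup>\<star> + R\<^sub>3\<^sup>\<star>)\<close>.

  Underneath lies a development in coordinates of the Levi-Civita connection along a map: closure of smooth
  functions under the operations occurring in the Christoffel symbols (including matrix inversion), symmetry of second
  derivatives, metric compatibility, and the symmetries of the curvature tensor.\<close>

section \<open>Calculus of smooth functions\<close>

named_theorems smooth_intros

lemma Ck_on_cong:
  assumes "open S" "\<And>x. x \<in> S \<Longrightarrow> f x = g x" "Ck_on k S f"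
  shows "Ck_on k S g"
  using assms(2,3)
proof (induction k arbitrary: f g)
  case 0
  then show ?case using continuous_on_cong by fastforce
next
  case (Suc k)
  have D: "f differentiable (at x)" if "x \<in> S" for x
    using Suc.prems(2) that by auto
  have d: "frechet_derivative f (at x) = frechet_derivative g (at x)" if "x \<in> S" for x
    by (rule frechet_derivative_transform_within_open[OF D \<open>open S\<close> that])
       (use that Suc.prems(1) in auto)
  have "g differentiable (at x)" if "x \<in> S" for x
    using has_derivative_transform_within_open[where f=f, OF _ \<open>open S\<close> that Suc.prems(1)] D[OF that]
    unfolding differentiable_def by blast
  moreover have "Ck_on k S (\<lambda>x. frechet_derivative g (at x) v)" for v
    by (rule Suc.IH[of "\<lambda>x. frechet_derivative f (at x) v"]) (use Suc.prems d in auto)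
  ultimately show ?case by simp
qed

lemma Ck_on_SucD: "Ck_on (Suc k) S f \<Longrightarrow> Ck_on k S f"
proof (induction k arbitrary: f)
  case 0
  then show ?case
    by (simp add: continuous_at_imp_continuous_on differentiable_imp_continuous_within)
next
  case (Suc k)
  then show ?case by (metis Ck_on.simps(2))
qed

text \<open>The recursive definition of \<open>Ck_on\<close> speaks of the derivative chosen by \<open>frechet_derivative\<close>; this rule
  lets one exhibit any formula for the derivative instead, which is how the closure properties below are proved by
  induction on the order.\<close>

lemma Ck_on_SucI:
  assumes "open S" "\<And>x. x \<in> S \<Longrightarrow> (f has_derivative f' x) (at x)"
    and "\<And>v. Ck_on k S (\<lambda>x. f' x v)"
  shows "Ck_on (Suc k) S f"
proof -
  have "frechet_derivative f (at x) = f' x" if "x \<in> S" for x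
    using assms(2)[OF that] frechet_derivative_at by metis
  then have "Ck_on k S (\<lambda>x. frechet_derivative f (at x) v)" for v
    by (intro Ck_on_cong[OF assms(1) _ assms(3)[of v]]) auto
  then show ?thesis using assms(2) by (auto simp: differentiable_def)
qed

lemma Ck_on_has_derivative:
  "Ck_on (Suc k) S f \<Longrightarrow> x \<in> S \<Longrightarrow> (f has_derivative frechet_derivative f (at x)) (at x)"
  by (simp add: frechet_derivative_works)

lemma Ck_on_const: "Ck_on k S (\<lambda>x. c)"
  by (induction k arbitrary: c) auto

lemma Ck_on_ident: "Ck_on k S (\<lambda>x. x)"
  by (cases k) (auto simp: Ck_on_const)

lemma Ck_on_linear:
  assumes "bounded_linear L" "open S" "Ck_on k S f"
  shows "Ck_on k S (\<lambda>x. L (f x))"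
  using assms(3)
proof (induction k arbitrary: f)
  case 0
  then show ?case using bounded_linear.continuous_on[OF assms(1)] by simp
next
  case (Suc k)
  then show ?case
    by (intro Ck_on_SucI[where f'="\<lambda>x v. L (frechet_derivative f (at x) v)"] assms
        bounded_linear.has_derivative[OF assms(1)] Ck_on_has_derivative[of k]) auto
qed

lemma Ck_on_add:
  assumes "open S" "Ck_on k S f" "Ck_on k S g"
  shows "Ck_on k S (\<lambda>x. f x + g x)"
  using assms(2,3)
proof (induction k arbitrary: f g)
  case 0
  then show ?case by (simp add: continuous_on_add)
next
  case (Suc k)
  show ?case
    by (rule Ck_on_SucI[OF assms(1) has_derivative_add[OF Ck_on_has_derivative[OF Suc.prems(1)]
          Ck_on_has_derivative[OF Suc.prems(2)]] Suc.IH]) (use Suc.prems in auto)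
qed

lemma Ck_on_bilinear:
  assumes "bounded_bilinear b" "open S" "Ck_on k S f" "Ck_on k S g"
  shows "Ck_on k S (\<lambda>x. b (f x) (g x))"
  using assms(3,4)
proof (induction k arbitrary: f g)
  case 0
  then show ?case using bounded_bilinear.continuous_on[OF assms(1)] by simp
next
  case (Suc k)
  show ?case
    by (rule Ck_on_SucI[OF assms(2) bounded_bilinear.FDERIV[OF assms(1)
          Ck_on_has_derivative[OF Suc.prems(1)] Ck_on_has_derivative[OF Suc.prems(2)]]
          Ck_on_add[OF assms(2) Suc.IH Suc.IH]])
       (use Suc.prems Ck_on_SucD[OF Suc.prems(1)] Ck_on_SucD[OF Suc.prems(2)] in auto)
qed

lemma Ck_on_sum:
  assumes "open S" "\<And>i. i \<in> I \<Longrightarrow> Ck_on k S (f i)"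
  shows "Ck_on k S (\<lambda>x. \<Sum>i\<in>I. f i x)"
  using assms(2)
  by (induction I rule: infinite_finite_induct) (auto simp: Ck_on_const Ck_on_add assms(1))

lemma linear_expand_Basis:
  fixes L :: "'a::euclidean_space \<Rightarrow> 'b::real_vector"
  assumes "linear L"
  shows "L v = (\<Sum>b\<in>Basis. (v \<bullet> b) *\<^sub>R L b)"
  by (metis (no_types, lifting) assms euclidean_representation linear_scale linear_sum sum.cong)

text \<open>By the chain rule, \<open>D(g \<circ> f)(v)\<close> is the sum over basis vectors \<open>b\<close> of the \<open>b\<close>-component of \<open>Df(v)\<close> times
  \<open>D\<^sub>b g \<circ> f\<close>. Expanding in a basis separates the point from the direction, so that the induction hypothesis applies to
  the directional derivatives of \<open>g\<close>.\<close>

lemma Ck_on_compose: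
  fixes f :: "'a::euclidean_space \<Rightarrow> 'b::euclidean_space"
  assumes "open S" "open T" "Ck_on k S f" "Ck_on k T g" "\<And>x. x \<in> S \<Longrightarrow> f x \<in> T"
  shows "Ck_on k S (\<lambda>x. g (f x))"
  using assms(3,4)
proof (induction k arbitrary: g)
  case 0
  then show ?case using assms(5) by (auto intro: continuous_on_compose2)
next
  case (Suc k)
  have D: "((\<lambda>x. g (f x)) has_derivative
      (\<lambda>v. \<Sum>b\<in>Basis. (frechet_derivative f (at x) v \<bullet> b) *\<^sub>R frechet_derivative g (at (f x)) b)) (at x)"
    if "x \<in> S" for x
  proof -
    have g: "(g has_derivative frechet_derivative g (at (f x))) (at (f x))"
      by (rule Ck_on_has_derivative[OF Suc.prems(2)]) (use assms(5) that in auto)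
    have "frechet_derivative g (at (f x)) w
        = (\<Sum>b\<in>Basis. (w \<bullet> b) *\<^sub>R frechet_derivative g (at (f x)) b)" for w
      by (rule linear_expand_Basis[OF has_derivative_linear[OF g]])
    then show ?thesis
      by (intro has_derivative_eq_rhs[OF has_derivative_compose[OF
            Ck_on_has_derivative[OF Suc.prems(1) that] g]] ext)
  qed
  have "Ck_on k S (\<lambda>x. frechet_derivative f (at x) v)" for v
    using Suc.prems(1) by simp
  moreover have "Ck_on k S (\<lambda>x. frechet_derivative g (at (f x)) b)" for b
    by (rule Suc.IH[OF Ck_on_SucD[OF Suc.prems(1)]]) (use Suc.prems(2) in simp)
  ultimately show ?case
    by (intro Ck_on_SucI[OF assms(1), where f'="\<lambda>x v. \<Sum>b\<in>Basis. (frechet_derivative f (at x) v \<bullet> b)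
          *\<^sub>R frechet_derivative g (at (f x)) b"] D Ck_on_sum Ck_on_bilinear[OF bounded_bilinear_scaleR]
        Ck_on_linear[OF bounded_linear_inner_left] assms(1))
qed

text \<open>The derivative of \<open>1/f\<close> is again a product of \<open>Df\<close> and \<open>1/f\<close>, to which the induction hypothesis applies.\<close>

lemma Ck_on_inverse:
  fixes f :: "'a::euclidean_space \<Rightarrow> real"
  assumes "open S" "\<And>x. x \<in> S \<Longrightarrow> f x \<noteq> 0" "Ck_on k S f"
  shows "Ck_on k S (\<lambda>x. inverse (f x))"
  using assms(3)
proof (induction k)
  case 0
  then show ?case using assms(2) by (auto intro!: continuous_on_inverse)
next
  case (Suc k)
  have D: "((\<lambda>x. inverse (f x)) has_derivative
      (\<lambda>v. - (inverse (f x) * frechet_derivative f (at x) v * inverse (f x)))) (at x)" if "x \<in> S" for x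
    by (rule has_derivative_eq_rhs[OF Deriv.has_derivative_inverse[OF assms(2)[OF that]
          Ck_on_has_derivative[OF Suc.prems that]]]) simp
  have "Ck_on k S (\<lambda>x. frechet_derivative f (at x) v)" for v
    using Suc.prems by simp
  moreover have "Ck_on k S (\<lambda>x. inverse (f x))"
    using Suc.IH[OF Ck_on_SucD[OF Suc.prems]] .
  ultimately show ?case
    by (intro Ck_on_SucI[OF assms(1), where f'="\<lambda>x v. - (inverse (f x) * frechet_derivative f (at x) v * inverse (f x))"]
        D Ck_on_linear[OF bounded_linear_minus[OF bounded_linear_ident]]
        Ck_on_bilinear[OF bounded_bilinear_mult] assms(1))
qed

lemma smooth_on_cong:
  "open S \<Longrightarrow> (\<And>x. x \<in> S \<Longrightarrow> f x = g x) \<Longrightarrow> smooth_on S f \<Longrightarrow> smooth_on S g"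
  unfolding smooth_on_def using Ck_on_cong by blast

lemma smooth_on_imp_differentiable: "smooth_on S f \<Longrightarrow> x \<in> S \<Longrightarrow> f differentiable (at x)"
  unfolding smooth_on_def by (metis Ck_on.simps(2))

lemma smooth_on_has_derivative:
  "smooth_on S f \<Longrightarrow> x \<in> S \<Longrightarrow> (f has_derivative frechet_derivative f (at x)) (at x)"
  using smooth_on_imp_differentiable frechet_derivative_works by blast

lemma smooth_on_imp_continuous: "smooth_on S f \<Longrightarrow> continuous_on S f"
  unfolding smooth_on_def by (metis Ck_on.simps(1))

lemma smooth_on_frechet_derivative_const [smooth_intros]:
  "smooth_on S f \<Longrightarrow> smooth_on S (\<lambda>x. frechet_derivative f (at x) v)"
  unfolding smooth_on_def by (metis Ck_on.simps(2))

lemma smooth_on_subset: "smooth_on S f \<Longrightarrow> T \<subseteq> S \<Longrightarrow> smooth_on T f"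
proof -
  have "Ck_on k S f \<Longrightarrow> T \<subseteq> S \<Longrightarrow> Ck_on k T f" for k
    by (induction k arbitrary: f) (auto intro: continuous_on_subset)
  then show "smooth_on S f \<Longrightarrow> T \<subseteq> S \<Longrightarrow> smooth_on T f"
    by (simp add: smooth_on_def)
qed

lemma smooth_on_const [smooth_intros]: "smooth_on S (\<lambda>x. c)"
  by (simp add: smooth_on_def Ck_on_const)

lemma smooth_on_ident [smooth_intros]: "smooth_on S (\<lambda>x. x)"
  by (simp add: smooth_on_def Ck_on_ident)

lemma smooth_on_linear:
  "bounded_linear L \<Longrightarrow> open S \<Longrightarrow> smooth_on S f \<Longrightarrow> smooth_on S (\<lambda>x. L (f x))"
  by (simp add: smooth_on_def Ck_on_linear)

lemma smooth_on_bilinear: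
  "bounded_bilinear b \<Longrightarrow> open S \<Longrightarrow> smooth_on S f \<Longrightarrow> smooth_on S g \<Longrightarrow> smooth_on S (\<lambda>x. b (f x) (g x))"
  by (simp add: smooth_on_def Ck_on_bilinear)

lemma smooth_on_add [smooth_intros]:
  "open S \<Longrightarrow> smooth_on S f \<Longrightarrow> smooth_on S g \<Longrightarrow> smooth_on S (\<lambda>x. f x + g x)"
  by (simp add: smooth_on_def Ck_on_add)

lemmas smooth_on_minus [smooth_intros] = smooth_on_linear[OF bounded_linear_minus[OF bounded_linear_ident]]

lemma smooth_on_diff [smooth_intros]:
  "open S \<Longrightarrow> smooth_on S f \<Longrightarrow> smooth_on S g \<Longrightarrow> smooth_on S (\<lambda>x. f x - g x)"
  using smooth_on_add[of S f "\<lambda>x. - g x"] smooth_on_minus[of S g] by simp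

lemma smooth_on_sum [smooth_intros]:
  "open S \<Longrightarrow> (\<And>i. i \<in> I \<Longrightarrow> smooth_on S (f i)) \<Longrightarrow> smooth_on S (\<lambda>x. \<Sum>i\<in>I. f i x)"
  by (simp add: smooth_on_def Ck_on_sum)

lemmas smooth_on_scaleR [smooth_intros] = smooth_on_bilinear[OF bounded_bilinear_scaleR]
lemmas smooth_on_mult [smooth_intros] = smooth_on_bilinear[OF bounded_bilinear_mult]
lemmas smooth_on_inner [smooth_intros] = smooth_on_bilinear[OF bounded_bilinear_inner]
lemmas smooth_on_vec_nth [smooth_intros] = smooth_on_linear[OF bounded_linear_vec_nth]

lemma smooth_on_inverse [smooth_intros]:
  fixes f :: "'a::euclidean_space \<Rightarrow> real"
  shows "open S \<Longrightarrow> (\<And>x. x \<in> S \<Longrightarrow> f x \<noteq> 0) \<Longrightarrow> smooth_on S f \<Longrightarrow> smooth_on S (\<lambda>x. inverse (f x))"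
  by (simp add: smooth_on_def Ck_on_inverse)

lemma smooth_on_divide [smooth_intros]:
  fixes f g :: "'a::euclidean_space \<Rightarrow> real"
  shows "open S \<Longrightarrow> (\<And>x. x \<in> S \<Longrightarrow> g x \<noteq> 0) \<Longrightarrow> smooth_on S f \<Longrightarrow> smooth_on S g
     \<Longrightarrow> smooth_on S (\<lambda>x. f x / g x)"
  unfolding divide_inverse by (intro smooth_intros)

lemma smooth_on_prod [smooth_intros]:
  fixes f :: "'i \<Rightarrow> 'a::euclidean_space \<Rightarrow> real"
  assumes "open S" "\<And>i. i \<in> I \<Longrightarrow> smooth_on S (f i)"
  shows "smooth_on S (\<lambda>x. \<Prod>i\<in>I. f i x)"
  using assms(2)
  by (induction I rule: infinite_finite_induct) (auto simp: smooth_on_const smooth_on_mult assms(1))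

lemma smooth_on_compose:
  fixes f :: "'a::euclidean_space \<Rightarrow> 'b::euclidean_space"
  shows "open S \<Longrightarrow> open T \<Longrightarrow> smooth_on S f \<Longrightarrow> smooth_on T g \<Longrightarrow> (\<And>x. x \<in> S \<Longrightarrow> f x \<in> T)
    \<Longrightarrow> smooth_on S (\<lambda>x. g (f x))"
  by (simp add: smooth_on_def Ck_on_compose)

lemma smooth_on_frechet_derivative [smooth_intros]:
  fixes f :: "'a::euclidean_space \<Rightarrow> 'b::euclidean_space"
  assumes "open S" "smooth_on S f" "smooth_on S v"
  shows "smooth_on S (\<lambda>x. frechet_derivative f (at x) (v x))"
  by (rule smooth_on_cong[where f="\<lambda>x. \<Sum>b\<in>Basis. (v x \<bullet> b) *\<^sub>R frechet_derivative f (at x) b"])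
    (use assms in \<open>auto intro!: smooth_intros
      linear_expand_Basis[symmetric, OF has_derivative_linear[OF smooth_on_has_derivative]]\<close>)

lemma bounded_linear_axis:
  "bounded_linear (\<lambda>x::'b::euclidean_space. axis i x :: 'b^'n)"
  unfolding linear_conv_bounded_linear[symmetric]
  by (rule linearI) (auto simp: vec_eq_iff axis_def)

lemma smooth_on_vec_lambda [smooth_intros]:
  fixes f :: "'n::finite \<Rightarrow> 'a::euclidean_space \<Rightarrow> 'b::euclidean_space"
  assumes "open S" "\<And>i. smooth_on S (f i)"
  shows "smooth_on S (\<lambda>x. \<chi> i. f i x)"
  by (rule smooth_on_cong[where f="\<lambda>x. \<Sum>i\<in>UNIV. axis i (f i x)"])
     (use assms in \<open>auto intro!: smooth_on_sum smooth_on_linear[OF bounded_linear_axis]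
        simp: vec_eq_iff\<close>, simp add: axis_def)

lemma smooth_on_det [smooth_intros]:
  fixes A :: "'a::euclidean_space \<Rightarrow> real^'n^'n"
  assumes "open S" "smooth_on S A"
  shows "smooth_on S (\<lambda>x. det (A x))"
  unfolding det_def using assms by (intro smooth_intros)

lemma matrix_inv_inverse:
  fixes A :: "'a::semiring_1^'n^'n"
  assumes "invertible A"
  shows "A ** matrix_inv A = mat 1" "matrix_inv A ** A = mat 1"
  using someI_ex[OF assms[unfolded invertible_def]] by (auto simp: matrix_inv_def)

text \<open>By Cramer's rule the entries of the inverse are quotients of determinants.\<close>

lemma smooth_on_matrix_inv [smooth_intros]:
  fixes A :: "'a::euclidean_space \<Rightarrow> real^'n^'n"
  assumes "open S" "smooth_on S A" "\<And>x. x \<in> S \<Longrightarrow> invertible (A x)"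
  shows "smooth_on S (\<lambda>x. matrix_inv (A x))"
proof -
  define M where "M B = (\<chi> k j. det (\<chi> i l. if l = k then axis j 1 $ i else B $ i $ l) / det B)"
    for B :: "real^'n^'n"
  have M: "matrix_inv B = M B" if "invertible B" for B
  proof -
    have "B *v (matrix_inv B *v axis j 1) = axis j 1" for j
      by (simp add: matrix_vector_mul_assoc matrix_inv_inverse[OF that])
    then have "matrix_inv B *v axis j 1
        = (\<chi> k. det (\<chi> i l. if l = k then axis j 1 $ i else B $ i $ l) / det B)" for j
      using cramer that invertible_det_nz by blast
    then show ?thesis
      by (simp add: M_def vec_eq_iff matrix_vector_mult_basis column_def)
  qed
  have [smooth_intros]: "smooth_on S (\<lambda>x. if P then f x else g x)"
    if "P \<Longrightarrow> smooth_on S f" "\<not> P \<Longrightarrow> smooth_on S g" for P and f g :: "'a \<Rightarrow> real"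
    using that by (cases P) simp_all
  have "smooth_on S (\<lambda>x. M (A x))"
    unfolding M_def using assms invertible_det_nz by (intro smooth_intros) auto
  then show ?thesis
    by (rule smooth_on_cong[OF assms(1), rotated]) (use assms(3) M in auto)
qed

section \<open>Symmetry of second derivatives\<close>

lemma DERIV_along_line:
  fixes h :: "'a::euclidean_space \<Rightarrow> real"
  assumes "(h has_derivative h') (at (p + t *\<^sub>R u))"
  shows "((\<lambda>t. h (p + t *\<^sub>R u)) has_real_derivative h' u) (at t)"
proof -
  have "((\<lambda>t. h (p + t *\<^sub>R u)) has_derivative (\<lambda>s. h' (s *\<^sub>R u))) (at t)"
    by (rule has_derivative_compose[where f="\<lambda>t. p + t *\<^sub>R u", OF _ assms]) (auto intro!: derivative_eq_intros)
  then show ?thesis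
    by (simp add: has_field_derivative_def linear_cmul[OF has_derivative_linear[OF assms]] mult_commute_abs)
qed

text \<open>The mean value theorem, applied first in the direction \<open>u\<close> to the increment in the direction \<open>v\<close> and then in
  the direction \<open>v\<close>, expresses the second difference of \<open>f\<close> over a parallelogram by a mixed derivative at an interior
  point. The left-hand side is symmetric in \<open>u\<close> and \<open>v\<close>.\<close>

lemma second_difference_mean_value:
  fixes f :: "'a::euclidean_space \<Rightarrow> real"
  assumes f: "smooth_on S f" and "s > 0"
    and S: "\<And>a b. 0 \<le> a \<Longrightarrow> a \<le> s \<Longrightarrow> 0 \<le> b \<Longrightarrow> b \<le> s \<Longrightarrow> x + a *\<^sub>R u + b *\<^sub>R v \<in> S"
  obtains a b where "0 < a" "a < s" "0 < b" "b < s"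
    "f (x + s *\<^sub>R u + s *\<^sub>R v) - f (x + s *\<^sub>R u) - f (x + s *\<^sub>R v) + f x
      = s * (s * frechet_derivative (\<lambda>y. frechet_derivative f (at y) u) (at (x + a *\<^sub>R u + b *\<^sub>R v)) v)"
proof -
  let ?D = "\<lambda>y. frechet_derivative f (at y) u"
  have d: "((\<lambda>t. f (x + t *\<^sub>R u + c *\<^sub>R v)) has_real_derivative ?D (x + t *\<^sub>R u + c *\<^sub>R v)) (at t)"
    if "0 \<le> t" "t \<le> s" "0 \<le> c" "c \<le> s" for t c
    using DERIV_along_line[of f _ "x + c *\<^sub>R v" t u] smooth_on_has_derivative[OF f S[of t c]] that
    by (simp add: add_ac)
  have "\<exists>a>0. a < s \<and> (f (x + s *\<^sub>R u + s *\<^sub>R v) - f (x + s *\<^sub>R u + 0 *\<^sub>R v))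
       - (f (x + 0 *\<^sub>R u + s *\<^sub>R v) - f (x + 0 *\<^sub>R u + 0 *\<^sub>R v))
       = (s - 0) * (?D (x + a *\<^sub>R u + s *\<^sub>R v) - ?D (x + a *\<^sub>R u + 0 *\<^sub>R v))"
    by (rule MVT2[OF \<open>s > 0\<close>]) (use \<open>s > 0\<close> in \<open>auto intro!: DERIV_diff d d[where c=0, simplified]\<close>)
  then obtain a where a: "0 < a" "a < s"
      "(f (x + s *\<^sub>R u + s *\<^sub>R v) - f (x + s *\<^sub>R u)) - (f (x + s *\<^sub>R v) - f x)
       = s * (?D (x + a *\<^sub>R u + s *\<^sub>R v) - ?D (x + a *\<^sub>R u))"
    by auto
  have e: "((\<lambda>t. ?D (x + a *\<^sub>R u + t *\<^sub>R v)) has_real_derivative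
      frechet_derivative ?D (at (x + a *\<^sub>R u + t *\<^sub>R v)) v) (at t)" if "0 \<le> t" "t \<le> s" for t
    by (rule DERIV_along_line, rule smooth_on_has_derivative[OF smooth_on_frechet_derivative_const[OF f] S])
       (use that a in auto)
  have "\<exists>b>0. b < s \<and> ?D (x + a *\<^sub>R u + s *\<^sub>R v) - ?D (x + a *\<^sub>R u + 0 *\<^sub>R v)
       = (s - 0) * frechet_derivative ?D (at (x + a *\<^sub>R u + b *\<^sub>R v)) v"
    by (rule MVT2[OF \<open>s > 0\<close>]) (auto intro!: e)
  then obtain b where "0 < b" "b < s" "?D (x + a *\<^sub>R u + s *\<^sub>R v) - ?D (x + a *\<^sub>R u)
       = s * frechet_derivative ?D (at (x + a *\<^sub>R u + b *\<^sub>R v)) v"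
    by auto
  with a show ?thesis by (intro that[of a b]) (auto simp: algebra_simps)
qed

text \<open>The second difference over the parallelogram spanned by \<open>s u\<close> and \<open>s v\<close> is \<open>s\<^sup>2\<close> times either mixed derivative,
  each at some point of the parallelogram; let \<open>s\<close> be small and use continuity of both.\<close>

lemma symmetric_second_derivative_real:
  fixes f :: "'a::euclidean_space \<Rightarrow> real"
  assumes f: "smooth_on S f" and "open S" "x \<in> S"
  shows "frechet_derivative (\<lambda>y. frechet_derivative f (at y) u) (at x) v
       = frechet_derivative (\<lambda>y. frechet_derivative f (at y) v) (at x) u"
proof -
  define F where "F w z y = frechet_derivative (\<lambda>y. frechet_derivative f (at y) w) (at y) z" for w z y
  have cont: "isCont (F w z) x" for w z
    using smooth_on_imp_continuous[of S "F w z"] f assms(2,3) continuous_on_eq_continuous_at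
    unfolding F_def by (blast intro: smooth_intros)
  have "F u v x = F v u x"
  proof (rule ccontr)
    assume ne: "F u v x \<noteq> F v u x"
    define d where "d = \<bar>F u v x - F v u x\<bar> / 2"
    have "d > 0" using ne by (simp add: d_def)
    obtain e0 where e0: "e0 > 0" "ball x e0 \<subseteq> S"
      using assms(2,3) open_contains_ball by blast
    obtain e1 where e1: "e1 > 0" "\<And>y. dist y x < e1 \<Longrightarrow> dist (F u v y) (F u v x) < d"
      using cont[of u v] \<open>d > 0\<close> unfolding continuous_at_eps_delta by blast
    obtain e2 where e2: "e2 > 0" "\<And>y. dist y x < e2 \<Longrightarrow> dist (F v u y) (F v u x) < d"
      using cont[of v u] \<open>d > 0\<close> unfolding continuous_at_eps_delta by blast
    define e where "e = Min {e0, e1, e2}"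
    define s where "s = e / (2 * (norm u + norm v + 1))"
    have n: "norm u + norm v + 1 > 0" by (simp add: add_nonneg_pos)
    have "e > 0" and "e \<le> e0" "e \<le> e1" "e \<le> e2" using e0 e1 e2 by (auto simp: e_def)
    then have "s > 0" using n by (simp add: s_def)
    have small: "dist (x + a *\<^sub>R w + b *\<^sub>R z) x < e"
      if "0 \<le> a" "a \<le> s" "0 \<le> b" "b \<le> s" "{w, z} = {u, v}" for a b w z
    proof -
      have "dist (x + a *\<^sub>R w + b *\<^sub>R z) x \<le> norm (a *\<^sub>R w) + norm (b *\<^sub>R z)"
        by (simp add: dist_norm add.assoc norm_triangle_ineq del: norm_scaleR)
      also have "\<dots> \<le> s * norm w + s * norm z"
        using that by (intro add_mono) (auto intro: mult_right_mono)
      also have "\<dots> = s * (norm u + norm v)"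
        using that(5) by (auto simp: doubleton_eq_iff algebra_simps)
      also have "\<dots> < e"
        using n \<open>e > 0\<close> by (simp add: s_def field_simps add_nonneg_pos)
      finally show ?thesis .
    qed
    have in_S: "x + a *\<^sub>R w + b *\<^sub>R z \<in> S"
      if "0 \<le> a" "a \<le> s" "0 \<le> b" "b \<le> s" "{w, z} = {u, v}" for a b w z
      using small[OF that] e0(2) \<open>e \<le> e0\<close> by (auto simp: dist_commute)
    obtain a b where ab: "0 < a" "a < s" "0 < b" "b < s"
      "f (x + s *\<^sub>R u + s *\<^sub>R v) - f (x + s *\<^sub>R u) - f (x + s *\<^sub>R v) + f x
        = s * (s * F u v (x + a *\<^sub>R u + b *\<^sub>R v))"
      unfolding F_def
      by (rule second_difference_mean_value[OF f \<open>s > 0\<close>, where u=u and v=v and x=x])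
         (use in_S in auto)
    obtain a' b' where ab': "0 < a'" "a' < s" "0 < b'" "b' < s"
      "f (x + s *\<^sub>R v + s *\<^sub>R u) - f (x + s *\<^sub>R v) - f (x + s *\<^sub>R u) + f x
        = s * (s * F v u (x + a' *\<^sub>R v + b' *\<^sub>R u))"
      unfolding F_def
      by (rule second_difference_mean_value[OF f \<open>s > 0\<close>, where u=v and v=u and x=x])
         (use in_S[of _ _ v u] in \<open>auto simp: insert_commute\<close>)
    have "s * (s * F u v (x + a *\<^sub>R u + b *\<^sub>R v)) = s * (s * F v u (x + a' *\<^sub>R v + b' *\<^sub>R u))"
      unfolding ab(5)[symmetric] ab'(5)[symmetric] by (simp add: add_ac)
    then have "F u v (x + a *\<^sub>R u + b *\<^sub>R v) = F v u (x + a' *\<^sub>R v + b' *\<^sub>R u)"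
      using \<open>s > 0\<close> by simp
    moreover have "dist (F u v (x + a *\<^sub>R u + b *\<^sub>R v)) (F u v x) < d"
      using small[of a b u v] ab \<open>e \<le> e1\<close> by (intro e1(2)) auto
    moreover have "dist (F v u (x + a' *\<^sub>R v + b' *\<^sub>R u)) (F v u x) < d"
      using small[of a' b' v u] ab' \<open>e \<le> e2\<close> by (intro e2(2)) (auto simp: insert_commute)
    ultimately show False
      by (simp add: d_def dist_real_def abs_if split: if_splits)
  qed
  then show ?thesis by (simp add: F_def)
qed

lemma frechet_derivative_linear_image:
  assumes "bounded_linear L" "f differentiable (at x)"
  shows "frechet_derivative (\<lambda>y. L (f y)) (at x) = (\<lambda>v. L (frechet_derivative f (at x) v))"
  using frechet_derivative_at[OF bounded_linear.has_derivative[OF assms(1)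
      assms(2)[unfolded frechet_derivative_works]]] by simp

text \<open>Componentwise reduction to the real-valued case.\<close>

lemma symmetric_second_derivative:
  fixes f :: "'a::euclidean_space \<Rightarrow> 'b::euclidean_space"
  assumes f: "smooth_on S f" and "open S" "x \<in> S"
  shows "frechet_derivative (\<lambda>y. frechet_derivative f (at y) u) (at x) v
       = frechet_derivative (\<lambda>y. frechet_derivative f (at y) v) (at x) u"
proof (rule euclidean_eqI)
  fix b :: 'b
  let ?L = "\<lambda>z. z \<bullet> b"
  have L: "bounded_linear ?L" by (rule bounded_linear_inner_left)
  have "?L (frechet_derivative (\<lambda>y. frechet_derivative f (at y) w) (at x) z)
      = frechet_derivative (\<lambda>y. frechet_derivative (\<lambda>y. ?L (f y)) (at y) w) (at x) z" for w z
  proof -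
    have "frechet_derivative (\<lambda>y. ?L (frechet_derivative f (at y) w)) (at x)
        = frechet_derivative (\<lambda>y. frechet_derivative (\<lambda>y. ?L (f y)) (at y) w) (at x)"
      by (rule frechet_derivative_transform_within_open[OF _ assms(2,3)])
         (use assms in \<open>auto intro!: smooth_on_imp_differentiable[of S] smooth_on_linear[OF L] smooth_intros
           simp: frechet_derivative_linear_image[OF L smooth_on_imp_differentiable[OF f]]\<close>)
    then show ?thesis
      using frechet_derivative_linear_image[OF L
          smooth_on_imp_differentiable[OF smooth_on_frechet_derivative_const[OF f]] ] assms(3)
      by metis
  qed
  then show "?L (frechet_derivative (\<lambda>y. frechet_derivative f (at y) u) (at x) v)
      = ?L (frechet_derivative (\<lambda>y. frechet_derivative f (at y) v) (at x) u)"
    using symmetric_second_derivative_real[OF smooth_on_linear[OF L assms(2) f] assms(2,3)] by simp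
qed

section \<open>The Levi-Civita connection in a coordinate domain\<close>

lemma bounded_bilinear_matrix_vector_mult:
  "bounded_bilinear ((*v) :: real^'n^'m \<Rightarrow> real^'n \<Rightarrow> real^'m)"
  unfolding bilinear_conv_bounded_bilinear[symmetric] bilinear_def
  by (auto intro!: linearI simp: matrix_vector_right_distrib matrix_vector_mult_add_rdistrib
      matrix_vector_mult_scaleR scaleR_matrix_vector_assoc)

lemmas smooth_on_matrix_vector_mult [smooth_intros] =
  smooth_on_bilinear[OF bounded_bilinear_matrix_vector_mult]

lemma smooth_on_inner_mat [smooth_intros]:
  "open S \<Longrightarrow> smooth_on S A \<Longrightarrow> smooth_on S u \<Longrightarrow> smooth_on S v
    \<Longrightarrow> smooth_on S (\<lambda>x. inner_mat (A x) (u x) (v x))"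
  unfolding inner_mat_def by (intro smooth_intros)

lemma inner_mat_simps:
  "inner_mat A (u + u') v = inner_mat A u v + inner_mat A u' v"
  "inner_mat A u (v + v') = inner_mat A u v + inner_mat A u v'"
  "inner_mat A (u - u') v = inner_mat A u v - inner_mat A u' v"
  "inner_mat A u (v - v') = inner_mat A u v - inner_mat A u v'"
  "inner_mat A (- u) v = - inner_mat A u v"
  "inner_mat A u (- v) = - inner_mat A u v"
  "inner_mat A (c *\<^sub>R u) v = c * inner_mat A u v"
  "inner_mat A u (c *\<^sub>R v) = c * inner_mat A u v"
  "inner_mat A 0 v = 0"
  "inner_mat A u 0 = 0"
  by (simp_all add: inner_mat_def inner_left_distrib inner_right_distrib inner_diff_left inner_diff_right
      matrix_vector_right_distrib matrix_vector_mult_diff_distrib matrix_vector_mult_scaleR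
      bounded_bilinear.minus_right[OF bounded_bilinear_matrix_vector_mult])

lemma inner_mat_sum_left: "inner_mat A (\<Sum>i\<in>I. f i) v = (\<Sum>i\<in>I. inner_mat A (f i) v)"
  by (simp add: inner_mat_def inner_sum_left)

lemma inner_mat_matrix_simps:
  "inner_mat (A + B) u v = inner_mat A u v + inner_mat B u v"
  "inner_mat (c *\<^sub>R A) u v = c * inner_mat A u v"
  by (simp_all add: inner_mat_def matrix_vector_mult_add_rdistrib inner_right_distrib
      flip: scaleR_matrix_vector_assoc)

lemma inner_mat_transpose: "transpose A = A \<Longrightarrow> inner_mat A u v = inner_mat A v u"
  unfolding inner_mat_def by (metis dot_lmul_matrix inner_commute transpose_matrix_vector)

lemma has_derivative_inner_mat:
  assumes "(A has_derivative A') (at x)" "(u has_derivative u') (at x)" "(v has_derivative v') (at x)"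
  shows "((\<lambda>y. inner_mat (A y) (u y) (v y)) has_derivative
    (\<lambda>h. inner_mat (A x) (u' h) (v x) + inner_mat (A x) (u x) (v' h) + inner_mat (A' h) (u x) (v x))) (at x)"
  using bounded_bilinear.FDERIV[OF bounded_bilinear_inner assms(2)
      bounded_bilinear.FDERIV[OF bounded_bilinear_matrix_vector_mult assms(1,3)]]
  by (simp add: inner_mat_def inner_right_distrib add_ac)

lemma linear_eq_on_axis:
  fixes f g :: "real^'n \<Rightarrow> 'b::real_vector"
  assumes "linear f" "linear g" "\<And>i. f (axis i 1) = g (axis i 1)"
  shows "f = g"
  by (rule linear_eq_stdbasis[OF assms(1,2)]) (auto simp: Basis_vec_def assms(3))

lemma smooth_on_frechet_derivative_compose:
  fixes F :: "'a::euclidean_space \<Rightarrow> 'b::euclidean_space"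
  assumes "open S" "open W" "smooth_on S F" "\<And>x. x \<in> S \<Longrightarrow> F x \<in> W" "smooth_on W f" "smooth_on S a"
  shows "smooth_on S (\<lambda>x. frechet_derivative f (at (F x)) (a x))"
  by (rule smooth_on_cong[where f="\<lambda>x. \<Sum>b\<in>Basis. (a x \<bullet> b) *\<^sub>R frechet_derivative f (at (F x)) b"])
    (use assms in \<open>auto intro!: smooth_intros smooth_on_compose[where g="\<lambda>y. frechet_derivative f (at y) b" for b]
      linear_expand_Basis[symmetric, OF has_derivative_linear[OF smooth_on_has_derivative]]\<close>)

locale metric_domain =
  fixes W :: "(real^'m) set" and H :: "real^'m \<Rightarrow> real^'m^'m"
  assumes open_W: "open W"
    and smooth_H: "smooth_on W H"
    and transpose_H: "x \<in> W \<Longrightarrow> transpose (H x) = H x"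
    and pos: "x \<in> W \<Longrightarrow> u \<noteq> 0 \<Longrightarrow> inner_mat (H x) u u > 0"
begin

abbreviation g :: "real^'m \<Rightarrow> real^'m \<Rightarrow> real^'m \<Rightarrow> real" where
  "g x \<equiv> inner_mat (H x)"

abbreviation \<Gamma> :: "real^'m \<Rightarrow> real^'m \<Rightarrow> real^'m \<Rightarrow> real^'m" where
  "\<Gamma> \<equiv> christoffel H"

abbreviation dH :: "real^'m \<Rightarrow> real^'m \<Rightarrow> real^'m^'m" where
  "dH x \<equiv> frechet_derivative H (at x)"

lemma g_commute: "x \<in> W \<Longrightarrow> g x u v = g x v u"
  by (rule inner_mat_transpose[OF transpose_H])

lemma g_eq_0_iff: "x \<in> W \<Longrightarrow> g x u u = 0 \<longleftrightarrow> u = 0"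
  using pos[of x u] by (cases "u = 0") (auto simp: inner_mat_simps)

lemma g_nonneg: "x \<in> W \<Longrightarrow> g x u u \<ge> 0"
  using pos[of x u] by (cases "u = 0") (auto simp: inner_mat_simps)

lemma g_eqI:
  assumes "x \<in> W" "\<And>w. g x u w = g x v w"
  shows "u = v"
  using g_eq_0_iff[OF assms(1), of "u - v"] assms(2)[of "u - v"] by (simp add: inner_mat_simps)

lemma invertible_H: "x \<in> W \<Longrightarrow> invertible (H x)"
  unfolding invertible_left_inverse matrix_left_invertible_ker
  using pos by (metis inner_mat_def inner_zero_right less_irrefl)

lemma has_derivative_H: "x \<in> W \<Longrightarrow> (H has_derivative dH x) (at x)"
  by (rule smooth_on_has_derivative[OF smooth_H])

lemma derivative_g_const:
  "x \<in> W \<Longrightarrow> frechet_derivative (\<lambda>y. g y v w) (at x) = (\<lambda>u. inner_mat (dH x u) v w)"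
  by (rule frechet_derivative_at[symmetric],
      rule has_derivative_eq_rhs[OF has_derivative_inner_mat[OF has_derivative_H has_derivative_const has_derivative_const]])
     (auto simp: inner_mat_simps)

lemma dH_commute:
  assumes "x \<in> W"
  shows "inner_mat (dH x u) v w = inner_mat (dH x u) w v"
proof -
  have "frechet_derivative (\<lambda>y. g y v w) (at x) = frechet_derivative (\<lambda>y. g y w v) (at x)"
    by (rule frechet_derivative_transform_within_open[OF _ open_W assms])
       (use assms in \<open>auto intro!: smooth_on_imp_differentiable[of W] smooth_intros smooth_H open_W g_commute\<close>)
  then show ?thesis by (simp add: derivative_g_const[OF assms] fun_eq_iff)
qed

lemma dH_linear: "x \<in> W \<Longrightarrow> linear (dH x)"
  by (rule has_derivative_linear[OF has_derivative_H])

lemma dH_simps: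
  assumes "x \<in> W"
  shows "dH x (u + v) = dH x u + dH x v" "dH x (c *\<^sub>R u) = c *\<^sub>R dH x u"
  using linear_add[OF dH_linear[OF assms]] linear_cmul[OF dH_linear[OF assms]] by auto

text \<open>The Koszul formula for constant vector fields. It characterizes the Christoffel symbols by nondegeneracy of
  \<open>g\<close>, so the symmetry, bilinearity and metric compatibility of \<open>\<Gamma>\<close> can be read off from it.\<close>

lemma g_christoffel:
  assumes x: "x \<in> W"
  shows "g x (\<Gamma> x u v) w = (inner_mat (dH x u) v w + inner_mat (dH x v) u w - inner_mat (dH x w) u v) / 2"
proof -
  define b where "b = (\<chi> l. (inner_mat (dH x u) v (axis l 1) + inner_mat (dH x v) u (axis l 1)
      - inner_mat (dH x (axis l 1)) u v) / 2)"
  have "\<Gamma> x u v = matrix_inv (H x) *v b"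
    unfolding christoffel_def b_def by (simp add: derivative_g_const[OF x])
  then have "H x *v \<Gamma> x u v = b"
    by (simp add: matrix_vector_mul_assoc matrix_inv_inverse[OF invertible_H[OF x]])
  then have "g x (\<Gamma> x u v) w = w \<bullet> b" for w
    by (metis g_commute inner_mat_def x)
  moreover have "(\<lambda>w. w \<bullet> b) = (\<lambda>w. (inner_mat (dH x u) v w + inner_mat (dH x v) u w
      - inner_mat (dH x w) u v) / 2)"
    by (rule linear_eq_on_axis)
       (auto intro!: linearI simp: inner_left_distrib inner_mat_simps inner_mat_matrix_simps dH_simps[OF x]
          field_simps inner_axis' b_def)
  ultimately show ?thesis by (simp add: fun_eq_iff)
qed

lemma christoffel_commute: "x \<in> W \<Longrightarrow> \<Gamma> x u v = \<Gamma> x v u"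
  by (rule g_eqI) (auto simp: g_christoffel dH_commute)

lemma christoffel_simps:
  assumes x: "x \<in> W"
  shows "\<Gamma> x (u + u') v = \<Gamma> x u v + \<Gamma> x u' v" "\<Gamma> x u (v + v') = \<Gamma> x u v + \<Gamma> x u v'"
    "\<Gamma> x (c *\<^sub>R u) v = c *\<^sub>R \<Gamma> x u v" "\<Gamma> x u (c *\<^sub>R v) = c *\<^sub>R \<Gamma> x u v"
  by (rule g_eqI[OF x]; simp add: g_christoffel x inner_mat_simps inner_mat_matrix_simps dH_simps field_simps)+

lemma metric_compatible:
  "x \<in> W \<Longrightarrow> inner_mat (dH x u) v w = g x (\<Gamma> x u v) w + g x v (\<Gamma> x u w)"
  by (simp add: g_commute[of x v] g_christoffel dH_commute[of x u w v] dH_commute[of x v w u] dH_commute[of x w v u] field_simps)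

end

section \<open>Covariant differentiation along a map\<close>

text \<open>The pull-back connection is studied along a map from a space of any dimension into the coordinate domain: along
  an immersion it differentiates the tension field, and along the identity it is the Levi-Civita connection itself.\<close>

locale metric_map = metric_domain W H
  for W :: "(real^'m) set" and H :: "real^'m \<Rightarrow> real^'m^'m" +
  fixes S :: "(real^'n) set" and F :: "real^'n \<Rightarrow> real^'m"
  assumes open_S: "open S" and smooth_F: "smooth_on S F" and F_in_W: "x \<in> S \<Longrightarrow> F x \<in> W"
begin

abbreviation dF :: "real^'n \<Rightarrow> real^'n \<Rightarrow> real^'m" where
  "dF x \<equiv> frechet_derivative F (at x)"

abbreviation D :: "(real^'n \<Rightarrow> real^'m) \<Rightarrow> real^'n \<Rightarrow> real^'n \<Rightarrow> real^'m" where
  "D \<equiv> pullback_cov H F"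

lemma smooth_along: "smooth_on W A \<Longrightarrow> smooth_on S (\<lambda>x. A (F x))"
  by (rule smooth_on_compose[OF open_S open_W smooth_F _ F_in_W])

lemma dF_linear: "x \<in> S \<Longrightarrow> linear (dF x)"
  by (rule has_derivative_linear[OF smooth_on_has_derivative[OF smooth_F]])

lemma smooth_christoffel_along:
  assumes "smooth_on S a" "smooth_on S b"
  shows "smooth_on S (\<lambda>x. \<Gamma> (F x) (a x) (b x))"
proof (rule smooth_on_cong[OF open_S])
  have [smooth_intros]: "smooth_on S (\<lambda>x. dH (F x) (c x))" if "smooth_on S c" for c
    by (rule smooth_on_frechet_derivative_compose[OF open_S open_W smooth_F F_in_W smooth_H that])
  show "smooth_on S (\<lambda>x. matrix_inv (H (F x)) *v (\<chi> l. (inner_mat (dH (F x) (a x)) (b x) (axis l 1)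
      + inner_mat (dH (F x) (b x)) (a x) (axis l 1)
      - inner_mat (dH (F x) (axis l 1)) (a x) (b x)) / 2))"
    by (intro smooth_intros open_S assms invertible_H F_in_W smooth_along smooth_H) simp_all
qed (simp add: christoffel_def derivative_g_const[OF F_in_W])

lemma smooth_D:
  assumes "smooth_on S V" "smooth_on S u"
  shows "smooth_on S (\<lambda>x. D V x (u x))"
  unfolding pullback_cov_def
  by (intro smooth_intros open_S assms smooth_christoffel_along smooth_F)

lemma D_linear: "x \<in> S \<Longrightarrow> V differentiable (at x) \<Longrightarrow> linear (D V x)"
  by (rule linearI)
    (simp_all add: pullback_cov_def christoffel_simps[OF F_in_W] linear_add[OF linear_frechet_derivative]
      linear_cmul[OF linear_frechet_derivative] linear_add[OF dF_linear] linear_cmul[OF dF_linear] algebra_simps)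

lemma D_cong:
  assumes "x \<in> S" "V differentiable (at x)" "\<And>y. y \<in> S \<Longrightarrow> V y = V' y"
  shows "D V x = D V' x"
  unfolding pullback_cov_def using assms
  by (simp add: frechet_derivative_transform_within_open[OF assms(2) open_S assms(1,3)])

text \<open>Differentiating \<open>g(V,Z)\<close> also differentiates the metric, along \<open>dF(u)\<close>; metric compatibility turns that term into
  the Christoffel parts of the two covariant derivatives.\<close>

lemma derivative_g_along:
  assumes x: "x \<in> S" and V: "V differentiable (at x)" and Z: "Z differentiable (at x)"
  shows "frechet_derivative (\<lambda>y. g (F y) (V y) (Z y)) (at x) u
    = g (F x) (D V x u) (Z x) + g (F x) (V x) (D Z x u)"
proof -
  have "((\<lambda>y. H (F y)) has_derivative (\<lambda>u. dH (F x) (dF x u))) (at x)"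
    by (rule has_derivative_compose[OF smooth_on_has_derivative[OF smooth_F x] has_derivative_H[OF F_in_W[OF x]]])
  from has_derivative_inner_mat[OF this V[unfolded frechet_derivative_works] Z[unfolded frechet_derivative_works]]
  have "frechet_derivative (\<lambda>y. g (F y) (V y) (Z y)) (at x)
    = (\<lambda>u. g (F x) (frechet_derivative V (at x) u) (Z x)
       + g (F x) (V x) (frechet_derivative Z (at x) u) + inner_mat (dH (F x) (dF x u)) (V x) (Z x))"
    by (rule frechet_derivative_at[symmetric])
  then show ?thesis
    by (simp add: metric_compatible F_in_W[OF x] pullback_cov_def inner_mat_simps)
qed

lemma D_add:
  assumes "x \<in> S" "V differentiable (at x)" "Z differentiable (at x)"
  shows "D (\<lambda>y. V y + Z y) x u = D V x u + D Z x u"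
  using frechet_derivative_at[OF has_derivative_add[OF assms(2,3)[unfolded frechet_derivative_works]], symmetric]
  by (simp add: pullback_cov_def christoffel_simps[OF F_in_W[OF assms(1)]])

lemma D_scaleR:
  assumes "x \<in> S" "f differentiable (at x)" "V differentiable (at x)"
  shows "D (\<lambda>y. f y *\<^sub>R V y) x u = frechet_derivative f (at x) u *\<^sub>R V x + f x *\<^sub>R D V x u"
  using frechet_derivative_at[OF has_derivative_scaleR[OF assms(2,3)[unfolded frechet_derivative_works]], symmetric]
  by (simp add: pullback_cov_def christoffel_simps[OF F_in_W[OF assms(1)]] scaleR_right_distrib)

lemma D_scaleR_const:
  assumes "x \<in> S" "V differentiable (at x)"
  shows "D (\<lambda>y. c *\<^sub>R V y) x u = c *\<^sub>R D V x u"
  using D_scaleR[OF assms(1) _ assms(2), of "\<lambda>_. c"] by simp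

lemma D_diff:
  assumes "x \<in> S" "V differentiable (at x)" "Z differentiable (at x)"
  shows "D (\<lambda>y. V y - Z y) x u = D V x u - D Z x u"
  using D_add[OF assms(1,2), of "\<lambda>y. (-1) *\<^sub>R Z y"] D_scaleR_const[OF assms(1,3), of "-1"] assms(3)
  by simp

text \<open>Symmetry of second derivatives together with vanishing torsion.\<close>

lemma D_dF_commute:
  assumes x: "x \<in> S"
  shows "D (\<lambda>y. dF y v) x u = D (\<lambda>y. dF y u) x v"
  using symmetric_second_derivative[OF smooth_F open_S x] christoffel_commute[OF F_in_W[OF x]]
  by (simp add: pullback_cov_def)

end

section \<open>Metric traces and orthonormal frames\<close>

definition orthonormal_frame :: "real^'n^'n \<Rightarrow> ('n \<Rightarrow> real^'n) \<Rightarrow> bool" where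
  "orthonormal_frame A f \<longleftrightarrow> (\<forall>i j. inner_mat A (f i) (f j) = (if i = j then 1 else 0))"

text \<open>Gram--Schmidt applied to the coordinate basis, one index at a time. The frame vectors constructed from the
  indices in \<open>I\<close> have no components outside \<open>I\<close>, so the next coordinate vector stays nonzero after projection.\<close>

lemma orthonormal_frame_exists:
  assumes sym: "transpose A = A" and pos: "\<And>u. u \<noteq> 0 \<Longrightarrow> inner_mat A u u > 0"
  obtains f where "orthonormal_frame A f"
proof -
  have "\<exists>f. (\<forall>i\<in>I. \<forall>j\<in>I. inner_mat A (f i) (f j) = (if i = j then 1 else 0)) \<and>
      (\<forall>i\<in>I. \<forall>k. k \<notin> I \<longrightarrow> f i $ k = 0)" if "finite I" for I :: "'a set"
    using that
  proof (induction I)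
    case (insert k I)
    then obtain f where orth: "\<And>i j. i \<in> I \<Longrightarrow> j \<in> I \<Longrightarrow> inner_mat A (f i) (f j) = (if i = j then 1 else 0)"
      and zero: "\<And>i l. i \<in> I \<Longrightarrow> l \<notin> I \<Longrightarrow> f i $ l = 0"
      by blast
    define v where "v = axis k 1 - (\<Sum>i\<in>I. inner_mat A (axis k 1) (f i) *\<^sub>R f i)"
    have "v $ k = 1"
      using zero[OF _ insert.hyps(2)] by (simp add: v_def axis_def)
    then have "v \<noteq> 0" by auto
    then have vv: "inner_mat A v v > 0" by (rule pos)
    have v0: "inner_mat A v (f j) = 0" if "j \<in> I" for j
    proof -
      have "inner_mat A (\<Sum>i\<in>I. inner_mat A (axis k 1) (f i) *\<^sub>R f i) (f j)
          = (\<Sum>i\<in>I. inner_mat A (axis k 1) (f i) * (if i = j then 1 else 0))"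
        by (simp add: inner_mat_sum_left inner_mat_simps orth that cong: sum.cong)
      also have "\<dots> = inner_mat A (axis k 1) (f j)"
        using that insert.hyps(1) by (simp add: if_distrib[of "\<lambda>x. _ * x"] sum.delta' cong: if_cong)
      finally show ?thesis by (simp add: v_def inner_mat_simps)
    qed
    define w where "w = (1 / sqrt (inner_mat A v v)) *\<^sub>R v"
    have "inner_mat A w w = 1"
      using vv by (simp add: w_def inner_mat_simps field_simps)
    moreover have "inner_mat A w (f j) = 0" "inner_mat A (f j) w = 0" if "j \<in> I" for j
      using v0[OF that] inner_mat_transpose[OF sym] by (auto simp: w_def inner_mat_simps)
    moreover have "w $ l = 0" if "l \<notin> insert k I" for l
      using that zero by (simp add: w_def v_def axis_def)
    ultimately have "(\<forall>i\<in>insert k I. \<forall>j\<in>insert k I. inner_mat A ((f(k := w)) i) ((f(k := w)) j) = (if i = j then 1 else 0)) \<and>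
      (\<forall>i\<in>insert k I. \<forall>l. l \<notin> insert k I \<longrightarrow> (f(k := w)) i $ l = 0)"
      using orth zero insert.hyps(2) by auto
    then show ?case by blast
  qed simp
  from this[of UNIV] show ?thesis
    using that unfolding orthonormal_frame_def by auto
qed

text \<open>If \<open>P\<close> is the matrix with columns \<open>f\<^sub>k\<close>, orthonormality reads \<open>P\<^sup>T A P = 1\<close>. A one-sided inverse of a square
  matrix is two-sided, so \<open>P P\<^sup>T A = 1\<close>: this gives both the inverse of \<open>A\<close> and the expansion of a vector in the frame.\<close>

lemma orthonormal_frame_matrix_inv:
  assumes f: "orthonormal_frame A f"
  shows "matrix_inv A $ i $ j = (\<Sum>k\<in>UNIV. f k $ i * f k $ j)"
    and "w = (\<Sum>k\<in>UNIV. inner_mat A (f k) w *\<^sub>R f k)"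
proof -
  define P where "P = (\<chi> i k. f k $ i)"
  have P: "P *v axis k 1 = f k" for k
    by (simp add: P_def matrix_vector_mult_basis column_def vec_eq_iff)
  have "(transpose P ** (A ** P)) $ i $ j = inner_mat A (f i) (f j)" for i j
    by (simp add: P_def matrix_matrix_mult_def transpose_def inner_mat_def matrix_vector_mult_def inner_vec_def)
  then have "transpose P ** (A ** P) = mat 1"
    using f by (simp add: vec_eq_iff orthonormal_frame_def mat_def)
  then have "(transpose P ** A) ** P = mat 1"
    by (simp add: matrix_mul_assoc)
  then have 1: "P ** (transpose P ** A) = mat 1"
    by (rule matrix_left_right_inverse1)
  then have 2: "(P ** transpose P) ** A = mat 1"
    by (simp add: matrix_mul_assoc)
  then have "A ** (P ** transpose P) = mat 1"
    by (rule matrix_left_right_inverse1)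
  with 2 have "invertible A"
    unfolding invertible_def by blast
  then have "matrix_inv A = ((P ** transpose P) ** A) ** matrix_inv A"
    by (simp add: 2)
  also have "\<dots> = P ** transpose P"
    using matrix_inv_inverse(1)[OF \<open>invertible A\<close>] by (metis matrix_mul_assoc matrix_mul_rid)
  finally show "matrix_inv A $ i $ j = (\<Sum>k\<in>UNIV. f k $ i * f k $ j)"
    by (simp add: P_def matrix_matrix_mult_def transpose_def)
  have "w = P *v (transpose P *v (A *v w))"
    using 1 by (simp add: matrix_vector_mul_assoc matrix_mul_assoc)
  also have "transpose P *v (A *v w) = (\<chi> k. inner_mat A (f k) w)"
    by (simp add: P_def vec_eq_iff matrix_vector_mult_def transpose_def inner_mat_def inner_vec_def)
  finally show "w = (\<Sum>k\<in>UNIV. inner_mat A (f k) w *\<^sub>R f k)"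
    by (simp add: P_def vec_eq_iff matrix_vector_mult_def mult.commute)
qed

lemma vec_axis_expansion: "(u :: real^'n) = (\<Sum>i\<in>UNIV. u $ i *\<^sub>R axis i 1)"
  by (simp add: vec_eq_iff axis_def if_distrib[of "\<lambda>x. _ * x"] cong: if_cong)

lemma metric_trace_orthonormal_frame:
  fixes b :: "real^'n \<Rightarrow> real^'n \<Rightarrow> real"
  assumes f: "orthonormal_frame A f" and b: "bilinear b"
  shows "metric_trace A b = (\<Sum>k\<in>UNIV. b (f k) (f k))"
proof -
  have "b u u = (\<Sum>i\<in>UNIV. \<Sum>j\<in>UNIV. u $ i * u $ j * b (axis i 1) (axis j 1))" for u
  proof -
    have "b u u = b (\<Sum>i\<in>UNIV. u $ i *\<^sub>R axis i 1) (\<Sum>j\<in>UNIV. u $ j *\<^sub>R axis j 1)"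
      by (simp flip: vec_axis_expansion)
    also have "\<dots> = (\<Sum>i\<in>UNIV. \<Sum>j\<in>UNIV. u $ i * u $ j * b (axis i 1) (axis j 1))"
      by (simp add: bilinear_sum[OF b] sum.cartesian_product case_prod_beta
          bilinear_lmul[OF b] bilinear_rmul[OF b] mult_ac)
    finally show ?thesis .
  qed
  then have "(\<Sum>k\<in>UNIV. b (f k) (f k))
      = (\<Sum>k\<in>UNIV. \<Sum>i\<in>UNIV. \<Sum>j\<in>UNIV. f k $ i * f k $ j * b (axis i 1) (axis j 1))"
    by simp
  also have "\<dots> = (\<Sum>i\<in>UNIV. \<Sum>j\<in>UNIV. \<Sum>k\<in>UNIV. f k $ i * f k $ j * b (axis i 1) (axis j 1))"
    by (subst sum.swap) (intro sum.cong refl sum.swap)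
  finally show ?thesis
    by (simp add: metric_trace_def orthonormal_frame_matrix_inv(1)[OF f] sum_distrib_right)
qed

lemma inner_mat_metric_trace:
  "inner_mat B (metric_trace A b) z = metric_trace A (\<lambda>u v. inner_mat B (b u v) z)"
  by (simp add: metric_trace_def inner_mat_sum_left inner_mat_simps)

lemma metric_trace_linear:
  fixes b b' :: "real^'n \<Rightarrow> real^'n \<Rightarrow> real"
  shows "metric_trace A (\<lambda>u v. b u v + b' u v) = metric_trace A b + metric_trace A b'"
    and "metric_trace A (\<lambda>u v. c * b u v) = c * metric_trace A b"
  by (simp_all add: metric_trace_def sum.distrib sum_distrib_left algebra_simps)

lemma bilinear_inner_mat: "bilinear (inner_mat A)"
  unfolding bilinear_def by (auto intro!: linearI simp: inner_mat_simps)

lemma metric_trace_inner_mat: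
  fixes A :: "real^'n^'n"
  assumes "orthonormal_frame A f"
  shows "metric_trace A (inner_mat A) = real CARD('n)"
  using assms by (simp add: metric_trace_orthonormal_frame[OF assms bilinear_inner_mat])
    (simp add: orthonormal_frame_def)

text \<open>Parseval's identity for the frame.\<close>

lemma metric_trace_covector_square:
  assumes f: "orthonormal_frame A f"
  shows "metric_trace A (\<lambda>u v. inner_mat A u w * inner_mat A v w) = inner_mat A w w"
proof -
  have "bilinear (\<lambda>u v. inner_mat A u w * inner_mat A v w)"
    unfolding bilinear_def by (auto intro!: linearI simp: inner_mat_simps algebra_simps)
  then have "metric_trace A (\<lambda>u v. inner_mat A u w * inner_mat A v w)
      = inner_mat A (\<Sum>k\<in>UNIV. inner_mat A (f k) w *\<^sub>R f k) w"
    by (simp add: metric_trace_orthonormal_frame[OF f] inner_mat_sum_left inner_mat_simps)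
  then show ?thesis
    by (simp flip: orthonormal_frame_matrix_inv(2)[OF f])
qed

section \<open>The tension field of an isometric immersion\<close>

locale isometric_patch = metric_map W H S F + source: metric_domain S G
  for W :: "(real^'m) set" and H :: "real^'m \<Rightarrow> real^'m^'m"
    and S :: "(real^'n) set" and F :: "real^'n \<Rightarrow> real^'m" and G :: "real^'n \<Rightarrow> real^'n^'n" +
  assumes isometric: "x \<in> S \<Longrightarrow> inner_mat (H (F x)) (frechet_derivative F (at x) u) (frechet_derivative F (at x) v)
    = inner_mat (G x) u v"
begin

abbreviation B :: "real^'n \<Rightarrow> real^'n \<Rightarrow> real^'n \<Rightarrow> real^'m" where
  "B \<equiv> second_ff G H F"

abbreviation \<tau> :: "real^'n \<Rightarrow> real^'m" where
  "\<tau> \<equiv> tension G H F"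

lemma second_ff_eq: "B x u v = D (\<lambda>y. dF y v) x u - dF x (christoffel G x u v)"
  by (simp add: second_ff_def cov_deriv_def)

lemma differentiable_dF: "x \<in> S \<Longrightarrow> (\<lambda>y. dF y v) differentiable (at x)"
  by (rule smooth_on_imp_differentiable[OF smooth_on_frechet_derivative_const[OF smooth_F]])

text \<open>The trilinear form \<open>C(u,v,w) = \<langle>B(u,v), dF(w)\<rangle>\<close> is symmetric in \<open>u, v\<close> since both connections are torsion-free, and
  skew in \<open>v, w\<close> since both are metric and \<open>F\<close> is isometric. A trilinear form with these two symmetries is zero.\<close>

lemma second_ff_normal:
  assumes x: "x \<in> S"
  shows "g (F x) (B x u v) (dF x w) = 0"
proof -
  let ?C = "\<lambda>u v w. g (F x) (B x u v) (dF x w)"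
  have skew: "?C u v w = - ?C u w v" for u v w
  proof -
    have "frechet_derivative (\<lambda>y. g (F y) (dF y v) (dF y w)) (at x) u
        = frechet_derivative (\<lambda>y. inner_mat (G y) v w) (at x) u"
      by (rule fun_cong, rule frechet_derivative_transform_within_open[OF _ open_S x])
         (use x in \<open>auto intro!: smooth_on_imp_differentiable[of S] smooth_intros smooth_along smooth_H smooth_F open_S isometric\<close>)
    then have "g (F x) (D (\<lambda>y. dF y v) x u) (dF x w) + g (F x) (dF x v) (D (\<lambda>y. dF y w) x u)
        = g (F x) (dF x (christoffel G x u v)) (dF x w) + g (F x) (dF x v) (dF x (christoffel G x u w))"
      by (simp add: derivative_g_along[OF x differentiable_dF[OF x] differentiable_dF[OF x]] isometric[OF x]
          source.derivative_g_const[OF x] source.metric_compatible[OF x])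
    then show ?thesis
      by (simp add: second_ff_eq inner_mat_simps g_commute[OF F_in_W[OF x], of "dF x v"])
  qed
  have sym: "?C u v w = ?C v u w" for u v w
    by (simp add: second_ff_eq D_dF_commute[OF x, of u v] source.christoffel_commute[OF x, of u v])
  show ?thesis
    using skew[of u v w] sym[of u w v] skew[of w u v] sym[of w v u] skew[of v w u] sym[of v u w] by linarith
qed

lemma tension_normal: "x \<in> S \<Longrightarrow> g (F x) (\<tau> x) (dF x w) = 0"
  by (simp add: tension_def inner_mat_metric_trace second_ff_normal) (simp add: metric_trace_def)

lemma smooth_tension: "smooth_on S \<tau>"
proof -
  interpret id: metric_map S G S "\<lambda>x. x"
    by unfold_locales (auto intro: source.open_W smooth_intros)
  have "smooth_on S (\<lambda>x. B x u v)" for u v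
    unfolding second_ff_eq
    by (intro smooth_intros open_S smooth_D smooth_F id.smooth_christoffel_along)
  then show ?thesis
    unfolding tension_def metric_trace_def
    by (intro smooth_intros open_S source.smooth_H source.invertible_H) simp_all
qed

lemma differentiable_tension: "x \<in> S \<Longrightarrow> \<tau> differentiable (at x)"
  by (rule smooth_on_imp_differentiable[OF smooth_tension])

text \<open>Differentiate \<open>\<langle>\<tau>, dF(v)\<rangle> = 0\<close>: the tangential part of \<open>\<nabla>\<tau>\<close> is minus the shape operator of the normal field \<open>\<tau>\<close>.\<close>

lemma D_tension_tangential:
  assumes x: "x \<in> S"
  shows "g (F x) (D \<tau> x u) (dF x v) = - g (F x) (B x u v) (\<tau> x)"
proof -
  have "frechet_derivative (\<lambda>y. g (F y) (\<tau> y) (dF y v)) (at x) u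
      = frechet_derivative (\<lambda>y. 0 :: real) (at x) u"
    by (rule fun_cong, rule frechet_derivative_transform_within_open[OF _ open_S x])
       (use x in \<open>auto intro!: smooth_on_imp_differentiable[of S] smooth_intros smooth_along smooth_H smooth_F
          open_S smooth_tension simp: tension_normal\<close>)
  then have "g (F x) (D \<tau> x u) (dF x v) + g (F x) (\<tau> x) (D (\<lambda>y. dF y v) x u) = 0"
    by (simp add: derivative_g_along[OF x differentiable_tension[OF x] differentiable_dF[OF x]])
  then show ?thesis
    using tension_normal[OF x, of "christoffel G x u v"]
    by (simp add: second_ff_eq inner_mat_simps g_commute[OF F_in_W[OF x], of _ "\<tau> x"])
qed

text \<open>The trace of \<open>\<langle>B(u,v), \<tau>\<rangle>\<close> is \<open>|\<tau>|\<^sup>2\<close>, and by the previous lemma this form is the tangential part of \<open>\<nabla>\<tau>\<close> up to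
  sign.\<close>

lemma tension_eq_0_if_parallel:
  assumes x: "x \<in> S" and "\<And>u. D \<tau> x u = 0"
  shows "\<tau> x = 0"
proof -
  have "g (F x) (B x u v) (\<tau> x) = 0" for u v
    using D_tension_tangential[OF x, of u v] assms(2) by (simp add: inner_mat_simps)
  then have "g (F x) (\<tau> x) (\<tau> x) = 0"
    by (subst tension_def) (simp add: inner_mat_metric_trace, simp add: metric_trace_def)
  then show ?thesis by (simp add: g_eq_0_iff F_in_W[OF x])
qed

text \<open>Differentiate \<open>|\<tau>|\<^sup>2 = c\<close> twice. The first derivative gives \<open>\<langle>\<nabla>\<^sub>u\<tau>, \<tau>\<rangle> = 0\<close> at all points, which also removes the
  correction term \<open>\<nabla>\<^bsub>\<nabla>\<^sub>u v\<^esub> \<tau>\<close> of the second covariant derivative.\<close>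

lemma rough_laplacian_tension:
  assumes const: "\<And>y. y \<in> S \<Longrightarrow> g (F y) (\<tau> y) (\<tau> y) = c" and x: "x \<in> S"
  shows "g (F x) (rough_laplacian G H F \<tau> x) (\<tau> x)
       = - metric_trace (G x) (\<lambda>u v. g (F x) (D \<tau> x u) (D \<tau> x v))"
proof -
  have orth: "g (F y) (D \<tau> y u) (\<tau> y) = 0" if y: "y \<in> S" for y u
  proof -
    have "frechet_derivative (\<lambda>y. g (F y) (\<tau> y) (\<tau> y)) (at y) u
        = frechet_derivative (\<lambda>y. c) (at y) u"
      by (rule fun_cong, rule frechet_derivative_transform_within_open[OF _ open_S y])
         (use y in \<open>auto intro!: smooth_on_imp_differentiable[of S] smooth_intros smooth_along smooth_H
          open_S smooth_tension simp: const\<close>)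
    then show ?thesis
      by (simp add: derivative_g_along[OF y differentiable_tension[OF y] differentiable_tension[OF y]]
          g_commute[OF F_in_W[OF y], of "\<tau> y"])
  qed
  have "g (F x) (second_cov G H F \<tau> x u v) (\<tau> x) = - g (F x) (D \<tau> x u) (D \<tau> x v)" for u v
  proof -
    have sm: "smooth_on S (\<lambda>y. D \<tau> y v)"
      by (rule smooth_D[OF smooth_tension smooth_on_const])
    have "frechet_derivative (\<lambda>y. g (F y) (D \<tau> y v) (\<tau> y)) (at x) u
        = frechet_derivative (\<lambda>y. 0 :: real) (at x) u"
      by (rule fun_cong, rule frechet_derivative_transform_within_open[OF _ open_S x])
         (use x in \<open>auto intro!: smooth_on_imp_differentiable[of S] smooth_on_inner_mat smooth_along smooth_H
          open_S smooth_tension sm simp: orth\<close>)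
    then have "g (F x) (D (\<lambda>y. D \<tau> y v) x u) (\<tau> x) + g (F x) (D \<tau> x v) (D \<tau> x u) = 0"
      by (simp add: derivative_g_along[OF x smooth_on_imp_differentiable[OF sm x] differentiable_tension[OF x]])
    then show ?thesis
      using orth[OF x] g_commute[OF F_in_W[OF x], of "D \<tau> x v" "D \<tau> x u"]
      by (simp add: second_cov_def inner_mat_simps)
  qed
  then show ?thesis
    by (simp add: rough_laplacian_def inner_mat_metric_trace) (simp add: metric_trace_def sum_negf)
qed

end

section \<open>Almost contact metric vector spaces\<close>

locale contact_metric_space =
  fixes A :: "real^'m^'m" and \<xi> \<eta> :: "real^'m" and P :: "real^'m^'m"
  assumes transpose_A: "transpose A = A"
    and pos_A: "u \<noteq> 0 \<Longrightarrow> inner_mat A u u > 0"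
    and eta_xi: "\<eta> \<bullet> \<xi> = 1"
    and phi_phi: "P *v (P *v u) = - u + (\<eta> \<bullet> u) *\<^sub>R \<xi>"
    and phi_isometric: "inner_mat A (P *v u) (P *v v) = inner_mat A u v - (\<eta> \<bullet> u) * (\<eta> \<bullet> v)"
    and eta_eq: "\<eta> \<bullet> u = inner_mat A u \<xi>"
begin

abbreviation ip where "ip \<equiv> inner_mat A"
abbreviation J where "J \<equiv> (*v) P"

lemma ip_commute: "ip u v = ip v u"
  by (rule inner_mat_transpose[OF transpose_A])

lemma J_J: "J (J u) = - u + ip u \<xi> *\<^sub>R \<xi>"
  by (simp add: phi_phi eta_eq)

lemma ip_xi_xi: "ip \<xi> \<xi> = 1"
  using eta_xi by (simp add: eta_eq)

text \<open>\<open>|\<phi>\<xi>|\<^sup>2 = |\<xi>|\<^sup>2 - \<eta>(\<xi>)\<^sup>2 = 0\<close>.\<close>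

lemma J_xi: "J \<xi> = 0"
proof -
  have "ip (J \<xi>) (J \<xi>) = 0"
    by (simp add: phi_isometric eta_eq ip_xi_xi)
  then show ?thesis using pos_A[of "J \<xi>"] by force
qed

lemma J_simps:
  "J (u + v) = J u + J v" "J (u - v) = J u - J v" "J (- u) = - J u" "J (c *\<^sub>R u) = c *\<^sub>R J u" "J 0 = 0"
  by (simp_all add: matrix_vector_right_distrib matrix_vector_mult_diff_distrib matrix_vector_mult_scaleR
      bounded_bilinear.minus_right[OF bounded_bilinear_matrix_vector_mult])

text \<open>Evaluate \<open>\<phi>\<^sup>3\<close> both as \<open>\<phi>(\<phi>\<^sup>2 u)\<close> and as \<open>\<phi>\<^sup>2(\<phi> u)\<close>.\<close>

lemma ip_J_xi: "ip (J u) \<xi> = 0" "ip \<xi> (J u) = 0"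
proof -
  have "J (J (J u)) = - J u"
    by (subst J_J[of u]) (simp add: J_simps J_xi)
  then have "ip (J u) \<xi> *\<^sub>R \<xi> = 0"
    using J_J[of "J u"] by simp
  then show "ip (J u) \<xi> = 0"
    using ip_xi_xi by (auto simp: inner_mat_simps)
  then show "ip \<xi> (J u) = 0"
    by (simp add: ip_commute)
qed

lemma ip_J_left: "ip (J u) v = - ip u (J v)"
proof -
  have "ip (J u) (J (J v)) = ip u (J v)"
    by (simp add: phi_isometric eta_eq ip_J_xi)
  then show ?thesis by (simp add: J_J inner_mat_simps ip_J_xi)
qed

lemma ip_J_swap: "ip u (J v) = - ip v (J u)"
  by (metis ip_J_left ip_commute)

lemma ip_J_self: "ip u (J u) = 0"
  using ip_J_swap[of u u] by simp

end

section \<open>Biharmonic hypersurfaces of constant mean curvature\<close>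

context isometric_patch
begin

text \<open>Codimension one: the tangent space and any nonzero normal vector together span everything.\<close>

lemma normal_orthogonal_in_range:
  assumes x: "x \<in> S" and card: "CARD('m) = CARD('n) + 1" and t: "\<And>v. g (F x) t (dF x v) = 0"
    and "t \<noteq> 0" and z: "g (F x) z t = 0"
  shows "z \<in> range (dF x)"
proof -
  have tt: "g (F x) t t \<noteq> 0"
    using \<open>t \<noteq> 0\<close> g_eq_0_iff[OF F_in_W[OF x]] by blast
  have lin: "linear (dF x)" by (rule dF_linear[OF x])
  have "inj (dF x)"
    unfolding linear_injective_0[OF lin]
    using isometric[OF x] source.g_eq_0_iff[OF x] by (metis inner_mat_simps(9))
  then have "dim (range (dF x)) = CARD('n)"
    using dim_image_eq[OF lin, of UNIV] by (simp add: dim_UNIV)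
  moreover have "t \<notin> range (dF x)"
    using t tt by auto
  moreover have sp: "span (range (dF x)) = range (dF x)"
    using span_linear_image[OF lin, of UNIV] by simp
  ultimately have "dim (insert t (range (dF x))) = CARD('m)"
    by (subst dim_insert, subst sp) (simp add: card)
  then have "span (insert t (range (dF x))) = UNIV"
    by (intro dim_eq_full[THEN iffD1]) simp
  then obtain a where "z - a *\<^sub>R t \<in> range (dF x)"
    using span_breakdown_eq[of z t "range (dF x)"] sp by auto
  then obtain v where v: "z = dF x v + a *\<^sub>R t"
    by (auto simp: algebra_simps)
  then have "a * g (F x) t t = 0"
    using z t[of v] by (simp add: inner_mat_simps g_commute[OF F_in_W[OF x], of "dF x v"])
  then show ?thesis using v tt by auto
qed

lemma source_frame:
  assumes "x \<in> S"
  obtains f where "orthonormal_frame (G x) f"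
  using orthonormal_frame_exists[OF source.transpose_H[OF assms] source.pos[OF assms]] by blast

text \<open>With \<open>\<xi> = dF(w)\<close> and \<open>\<phi>t = dF(w')\<close>, the summands of \<open>\<langle>R(dF(u),t)dF(v), t\<rangle>\<close> are multiples of the metric of the
  hypersurface and of the squares of the covectors dual to \<open>w\<close> and \<open>w'\<close>; their traces are \<open>n\<close>, \<open>|\<xi>|\<^sup>2 = 1\<close> and
  \<open>|\<phi>t|\<^sup>2 = |t|\<^sup>2\<close>.\<close>

lemma curvature_trace_normal:
  assumes x: "x \<in> S" and card: "CARD('m) = CARD('n) + 1"
    and t: "\<And>v. g (F x) t (dF x v) = 0" and "t \<noteq> 0"
    and contact: "contact_metric_space (H (F x)) \<xi> \<eta> P" and xi: "\<xi> \<in> range (dF x)"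
    and R: "\<And>X Y Z. riem H (F x) X Y Z = f1 *\<^sub>R R1star (g (F x)) X Y Z
      + f2 *\<^sub>R R2star (g (F x)) \<xi> (\<lambda>u. \<eta> \<bullet> u) X Y Z + f3 *\<^sub>R R3star (g (F x)) (\<lambda>u. P *v u) X Y Z"
  shows "g (F x) (metric_trace (G x) (\<lambda>u v. riem H (F x) (dF x u) t (dF x v))) t
      = - (real CARD('n) * f1 - f2 + 3 * f3) * g (F x) t t"
proof -
  interpret C: contact_metric_space "H (F x)" \<xi> \<eta> P by (rule contact)
  obtain f where f: "orthonormal_frame (G x) f" using source_frame[OF x] .
  obtain w where w: "\<xi> = dF x w" using xi by blast
  have "g (F x) (C.J t) t = 0"
    using C.ip_J_self[of t] by (simp add: C.ip_commute)
  then obtain w' where w': "C.J t = dF x w'"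
    using normal_orthogonal_in_range[OF x card t \<open>t \<noteq> 0\<close>] by blast
  have t': "g (F x) (dF x v) t = 0" for v
    using t[of v] by (simp add: C.ip_commute)
  have xi0: "g (F x) t \<xi> = 0" "g (F x) \<xi> t = 0"
    using t t' by (simp_all add: w)
  have "g (F x) (riem H (F x) (dF x u) t (dF x v)) t
      = (- f1 * g (F x) t t) * inner_mat (G x) u v
        + (f2 * g (F x) t t) * (inner_mat (G x) u w * inner_mat (G x) v w)
        + (- 3 * f3) * (inner_mat (G x) u w' * inner_mat (G x) v w')" for u v
  proof -
    have "inner_mat (G x) v w = g (F x) (dF x v) \<xi>" "inner_mat (G x) v w' = g (F x) (dF x v) (C.J t)" for v
      by (simp_all add: w w' isometric[OF x])
    then show ?thesis
      by (simp add: R R1star_def R2star_def R3star_def Let_def inner_mat_simps t t' C.eta_eq xi0 C.ip_J_left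
          C.ip_J_self isometric[OF x, symmetric] algebra_simps)
  qed
  then have "g (F x) (metric_trace (G x) (\<lambda>u v. riem H (F x) (dF x u) t (dF x v))) t
      = (- f1 * g (F x) t t) * real CARD('n) + (f2 * g (F x) t t) * inner_mat (G x) w w
        + (- 3 * f3) * inner_mat (G x) w' w'"
    by (simp only: inner_mat_metric_trace metric_trace_linear metric_trace_inner_mat[OF f]
        metric_trace_covector_square[OF f])
  also have "inner_mat (G x) w w = 1"
    using isometric[OF x, of w w] by (simp add: w[symmetric] C.ip_xi_xi)
  also have "inner_mat (G x) w' w' = g (F x) t t"
    using isometric[OF x, of w' w'] C.phi_isometric[of t t] by (simp add: w'[symmetric] C.eta_eq xi0)
  finally show ?thesis by (simp add: algebra_simps)
qed

text \<open>Pairing the biharmonic equation with \<open>\<tau>\<close> gives \<open>|\<nabla>\<tau>|\<^sup>2 = (n f\<^sub>1 - f\<^sub>2 + 3 f\<^sub>3) |\<tau>|\<^sup>2 \<le> 0\<close>. In an orthonormal frame the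
  left-hand side is a sum of squares, so \<open>\<tau>\<close> is parallel and therefore zero.\<close>

theorem constant_length_biharmonic_imp_harmonic:
  assumes x: "x \<in> S" and card: "CARD('m) = CARD('n) + 1"
    and const: "\<And>y. y \<in> S \<Longrightarrow> g (F y) (\<tau> y) (\<tau> y) = c"
    and biharmonic: "bitension G H F x = 0"
    and contact: "contact_metric_space (H (F x)) \<xi> \<eta> P" and xi: "\<xi> \<in> range (dF x)"
    and R: "\<And>X Y Z. riem H (F x) X Y Z = f1 *\<^sub>R R1star (g (F x)) X Y Z
      + f2 *\<^sub>R R2star (g (F x)) \<xi> (\<lambda>u. \<eta> \<bullet> u) X Y Z + f3 *\<^sub>R R3star (g (F x)) (\<lambda>u. P *v u) X Y Z"
    and le: "real CARD('n) * f1 - f2 + 3 * f3 \<le> 0"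
  shows "\<tau> x = 0"
proof (rule ccontr)
  assume nz: "\<tau> x \<noteq> 0"
  obtain f where f: "orthonormal_frame (G x) f" using source_frame[OF x] .
  have lin: "linear (D \<tau> x)" by (rule D_linear[OF x differentiable_tension[OF x]])
  have "bilinear (\<lambda>u v. g (F x) (D \<tau> x u) (D \<tau> x v))"
    unfolding bilinear_def using lin
    by (auto intro!: linearI simp: inner_mat_simps linear_add linear_cmul)
  note trace = metric_trace_orthonormal_frame[OF f this]
  have "0 = g (F x) (bitension G H F x) (\<tau> x)"
    by (simp add: biharmonic inner_mat_simps)
  also have "\<dots> = - (\<Sum>k\<in>UNIV. g (F x) (D \<tau> x (f k)) (D \<tau> x (f k)))
      + (real CARD('n) * f1 - f2 + 3 * f3) * g (F x) (\<tau> x) (\<tau> x)"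
    unfolding bitension_def
    using rough_laplacian_tension[OF const x]
      curvature_trace_normal[OF x card tension_normal[OF x] nz contact xi R] trace
    by (simp add: inner_mat_simps algebra_simps)
  finally have "(\<Sum>k\<in>UNIV. g (F x) (D \<tau> x (f k)) (D \<tau> x (f k))) \<le> 0"
    using mult_nonpos_nonneg[OF le g_nonneg[OF F_in_W[OF x], of "\<tau> x"]] by linarith
  then have "(\<Sum>k\<in>UNIV. g (F x) (D \<tau> x (f k)) (D \<tau> x (f k))) = 0"
    using g_nonneg[OF F_in_W[OF x]] by (meson antisym sum_nonneg)
  then have "D \<tau> x (f k) = 0" for k
    using g_nonneg[OF F_in_W[OF x]] g_eq_0_iff[OF F_in_W[OF x]] by (simp add: sum_nonneg_eq_0_iff)
  then have "D \<tau> x u = 0" for u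
    by (subst orthonormal_frame_matrix_inv(2)[OF f, of u])
       (simp add: linear_sum[OF lin] linear_cmul[OF lin])
  then have "\<tau> x = 0"
    by (rule tension_eq_0_if_parallel[OF x])
  then show False using nz by simp
qed

end

section \<open>Algebraic curvature tensors of Kaehler type\<close>

text \<open>The usual octahedron argument: the four Bianchi identities below, on the cyclic shifts of \<open>(x, y, z, w)\<close>, combine
  to the claim after normalizing each term with the two skew symmetries.\<close>

lemma curvature_pair_symmetric:
  fixes T :: "'v \<Rightarrow> 'v \<Rightarrow> 'v \<Rightarrow> 'v \<Rightarrow> real"
  assumes skew12: "\<And>x y z w. T x y z w = - T y x z w"
    and skew34: "\<And>x y z w. T x y z w = - T x y w z"
    and bianchi: "\<And>x y z w. T x y z w + T y z x w + T z x y w = 0"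
  shows "T x y z w = T z w x y"
proof -
  note b = bianchi[of x y z w] bianchi[of y z w x] bianchi[of z w x y] bianchi[of w x y z]
  show ?thesis
    using b skew12[of y z x w] skew34[of z y x w] skew12[of z x y w] skew34[of x z y w]
      skew12[of z w y x] skew34[of z w y x] skew12[of w y z x] skew34[of y w z x]
      skew12[of x y w z] skew34[of x y w z] skew12[of w x z y] skew34[of w x z y]
      skew12[of y z w x] skew34[of y z w x] skew12[of x z w y] skew34[of x z w y]
      skew12[of y w x z] skew34[of y w x z] skew34[of y z x w] skew34[of z x y w]
      skew34[of w y z x] skew12[of x w y z] skew34[of w x y z] skew34[of x w y z]
    by linarith
qed

text \<open>Polarizing \<open>T(x, Jx, Jx, x) = 0\<close> relates \<open>T(x, Jx, y, Jy)\<close> to \<open>T(x, Jy, x, Jy)\<close>, and the Bianchi identity then gives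
  \<open>3 T(x, Jy, x, Jy) + T(x, y, x, y) = 0\<close>. Replacing \<open>y\<close> by \<open>Jy\<close> exchanges the two terms, so both vanish. Thus all
  sectional curvatures are zero, and a curvature tensor without sectional curvature is zero. The hypothesis \<open>J_J\<close> asks for
  \<open>J\<^sup>2 = -1\<close> only inside \<open>T\<close>, which admits an operator like \<open>\<phi>\<close> with a kernel on which \<open>T\<close> vanishes.\<close>

lemma kaehler_curvature_eq_0:
  fixes T :: "'v::real_vector \<Rightarrow> 'v \<Rightarrow> 'v \<Rightarrow> 'v \<Rightarrow> real" and J :: "'v \<Rightarrow> 'v"
  assumes add: "\<And>x x' y z w. T (x + x') y z w = T x y z w + T x' y z w"
    and skew12: "\<And>x y z w. T x y z w = - T y x z w"
    and skew34: "\<And>x y z w. T x y z w = - T x y w z"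
    and bianchi: "\<And>x y z w. T x y z w + T y z x w + T z x y w = 0"
    and J_add: "\<And>x y. J (x + y) = J x + J y"
    and J_invariant: "\<And>x y z w. T x y (J z) w = - T x y z (J w)"
    and J_J: "\<And>x y z w. T x y (J (J z)) w = - T x y z w"
    and holomorphic: "\<And>x. T x (J x) (J x) x = 0"
  shows "T x y z w = 0"
proof -
  note pair = curvature_pair_symmetric[of T, OF skew12 skew34 bianchi]
  have diff: "T (x - x') y z w = T x y z w - T x' y z w" for x x' y z w
    using add[of "x - x'" x' y z w] by simp
  have J_diff: "J (x - y) = J x - J y" for x y
    using J_add[of "x - y" y] by simp
  have add2: "T x (y + y') z w = T x y z w + T x y' z w" for x y y' z w
    using skew12[of x "y + y'" z w] skew12[of x y z w] skew12[of x y' z w] add[of y y' x z w] by linarith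
  have add3: "T x y (z + z') w = T x y z w + T x y z' w" for x y z z' w
    using pair[of x y "z + z'" w] pair[of x y z w] pair[of x y z' w] add[of z z' w x y] by linarith
  have add4: "T x y z (w + w') = T x y z w + T x y z w'" for x y z w w'
    using skew34[of x y z "w + w'"] skew34[of x y z w] skew34[of x y z w'] add3[of x y w w' z] by linarith
  note add' = add2 add3 add4
  have diff': "T x (y - y') z w = T x y z w - T x y' z w" "T x y (z - z') w = T x y z w - T x y z' w"
    "T x y z (w - w') = T x y z w - T x y z w'" for x y y' z z' w w'
    using add'(1)[of x "y - y'" y' z w] add'(2)[of x y "z - z'" z' w] add'(3)[of x y z "w - w'" w'] by simp_all
  have J1: "T (J x) y z w = - T x (J y) z w" for x y z w
    using pair[of "J x" y z w] J_invariant[of z w x y] pair[of x "J y" z w] by simp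
  have JJ2: "T x (J (J y)) z w = - T x y z w" for x y z w
    using pair[of x "J (J y)" z w] skew34[of z w x "J (J y)"] J_J[of z w y x] skew34[of z w y x] pair[of x y z w]
    by simp
  have JJ4: "T x y z (J (J w)) = - T x y z w" for x y z w
    using pair[of x y z "J (J w)"] JJ2[of z w x y] pair[of x y z w] by simp
  have quartic: "T x (J x) x (J x) = 0" for x
    using holomorphic[of x] skew34[of x "J x" "J x" x] by simp
  have polar: "T x (J x) y (J y) + 2 * T x (J y) x (J y) = 0" for x y
  proof -
    have s1: "T y (J x) z w = T x (J y) z w" for x y z w
      using J1[of x y z w] skew12[of "J x" y z w] by simp
    have s2: "T x y z (J w) = T x y w (J z)" for x y z w
      using pair[of x y z "J w"] pair[of x y w "J z"] s1[of z w x y] by simp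
    \<comment> \<open>The sum of the quartic form at \<open>x + y\<close> and at \<open>x - y\<close> isolates the part that is quadratic in both
      \<open>x\<close> and \<open>y\<close>.\<close>
    have "T (x + y) (J (x + y)) (x + y) (J (x + y)) + T (x - y) (J (x - y)) (x - y) (J (x - y)) = 0"
      by (simp add: quartic)
    then show ?thesis
      using quartic[of x] quartic[of y] s1[of x y x "J y"] s1[of x y y "J x"] s2[of x "J y" x y] s2[of y "J x" x y]
        pair[of y "J y" x "J x"]
      by (simp add: J_add J_diff add add' diff diff')
  qed
  \<comment> \<open>Combine the polarized identity with the Bianchi identity for \<open>x, Jx, y\<close>.\<close>
  have "3 * T x (J y) x (J y) + T x y x y = 0" for x y
  proof -
    have "T (J x) y x (J y) = - T x (J y) x (J y)" by (rule J1)
    moreover have "T y x (J x) (J y) = - T x y x y"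
      using J_invariant[of y x x "J y"] JJ4[of y x x y] skew12[of y x x y] by simp
    ultimately show ?thesis
      using bianchi[of x "J x" y "J y"] polar[of x y] by linarith
  qed
  from this this[of _ "J _"] have sectional: "T x y x y = 0" for x y
    using JJ2[of x y x "J (J y)"] JJ4[of x y x y] by (smt (verit))
  have alt: "T x y z w = - T x w z y" for x y z w
  proof -
    have "T x y z y = 0" for x y z
      using sectional[of "x + z" y] sectional[of x y] sectional[of z y] pair[of z y x y] by (simp add: add add')
    from this[of x "y + w" z] this[of x y z] this[of x w z] show ?thesis
      by (simp add: add')
  qed
  \<comment> \<open>So \<open>T\<close> is invariant under cyclic permutations of its last three arguments, whose sum vanishes.\<close>
  have cyclic: "T x y z w = T x w y z" for x y z w
    using alt[of x y z w] skew34[of x w z y] by simp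
  have "T x y z w + T x z w y + T x w y z = 0"
    using bianchi[of y z w x] pair[of y z w x] skew12[of w x y z] skew34[of z w y x] pair[of z w x y]
      pair[of w y z x] skew12[of z x w y] by linarith
  then show ?thesis using cyclic[of x y z w] cyclic[of x z w y] by simp
qed

section \<open>The Riemann curvature tensor\<close>

sublocale metric_domain \<subseteq> self: metric_map W H W "\<lambda>x. x"
  by unfold_locales (auto intro: open_W smooth_on_ident)

context metric_domain
begin

text \<open>Constant vector fields commute, so only the two iterated derivatives remain.\<close>

lemma riem_eq: "x \<in> W \<Longrightarrow> riem H x u v w
    = self.D (\<lambda>y. self.D (\<lambda>_. w) y v) x u - self.D (\<lambda>y. self.D (\<lambda>_. w) y u) x v"
proof -
  have eq: "cov_deriv H (\<lambda>_. u) Y = (\<lambda>y. self.D Y y u)" for u Y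
    by (simp add: fun_eq_iff cov_deriv_def pullback_cov_def)
  assume "x \<in> W"
  then have "cov_deriv H (lie_bracket (\<lambda>_. u) (\<lambda>_. v)) (\<lambda>_. w) x = 0"
    using christoffel_simps(3)[of x 0 0 w] by (simp add: cov_deriv_def lie_bracket_def)
  then show ?thesis by (simp add: riem_def curvature_op_def eq)
qed

lemma differentiable_smooth: "x \<in> W \<Longrightarrow> smooth_on W Z \<Longrightarrow> Z differentiable (at x)"
  by (rule smooth_on_imp_differentiable)

lemma smooth_D_const [smooth_intros]: "smooth_on W Z \<Longrightarrow> smooth_on W (\<lambda>y. self.D Z y u)"
  by (rule self.smooth_D[OF _ smooth_on_const])

text \<open>The commutator of the covariant derivatives in two coordinate directions, applied to a vector field \<open>Z\<close>.
  The curvature is its value on constant fields; the Ricci identity below says that it depends on \<open>Z x\<close> only.\<close>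

definition ricci_commutator :: "(real^'m \<Rightarrow> real^'m) \<Rightarrow> real^'m \<Rightarrow> real^'m \<Rightarrow> real^'m \<Rightarrow> real^'m" where
  "ricci_commutator Z x u v
    = self.D (\<lambda>y. self.D Z y v) x u - self.D (\<lambda>y. self.D Z y u) x v"

lemma ricci_commutator_add:
  assumes x: "x \<in> W" and Z: "smooth_on W Z" "smooth_on W Z'"
  shows "ricci_commutator (\<lambda>y. Z y + Z' y) x u v = ricci_commutator Z x u v + ricci_commutator Z' x u v"
proof -
  have "self.D (\<lambda>y. self.D (\<lambda>y. Z y + Z' y) y v) x u
      = self.D (\<lambda>y. self.D Z y v) x u + self.D (\<lambda>y. self.D Z' y v) x u" for u v
  proof -
    have "self.D (\<lambda>y. self.D (\<lambda>y. Z y + Z' y) y v) x = self.D (\<lambda>y. self.D Z y v + self.D Z' y v) x"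
      by (rule self.D_cong[OF x])
        (auto intro!: differentiable_smooth x smooth_intros open_W Z self.D_add)
    then show ?thesis
      by (simp add: self.D_add x differentiable_smooth smooth_D_const Z)
  qed
  then show ?thesis by (simp add: ricci_commutator_def)
qed

text \<open>The terms with one derivative on \<open>f\<close> are symmetric in \<open>u, v\<close>, and so are the second derivatives of \<open>f\<close>.\<close>

lemma ricci_commutator_scaleR:
  assumes x: "x \<in> W" and f: "smooth_on W f" and Z: "smooth_on W Z"
  shows "ricci_commutator (\<lambda>y. f y *\<^sub>R Z y) x u v = f x *\<^sub>R ricci_commutator Z x u v"
proof -
  let ?df = "\<lambda>v y. frechet_derivative f (at y) v"
  have "self.D (\<lambda>y. self.D (\<lambda>y. f y *\<^sub>R Z y) y v) x u
      = (frechet_derivative (?df v) (at x) u *\<^sub>R Z x + ?df v x *\<^sub>R self.D Z x u)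
        + (?df u x *\<^sub>R self.D Z x v + f x *\<^sub>R self.D (\<lambda>y. self.D Z y v) x u)" for u v
  proof -
    have "self.D (\<lambda>y. self.D (\<lambda>y. f y *\<^sub>R Z y) y v) x
        = self.D (\<lambda>y. ?df v y *\<^sub>R Z y + f y *\<^sub>R self.D Z y v) x"
      by (rule self.D_cong[OF x])
        (auto intro!: differentiable_smooth x smooth_intros open_W Z f self.D_scaleR)
    moreover have "self.D (\<lambda>y. ?df v y *\<^sub>R Z y + f y *\<^sub>R self.D Z y v) x u = self.D (\<lambda>y. ?df v y *\<^sub>R Z y) x u + self.D (\<lambda>y. f y *\<^sub>R self.D Z y v) x u"
      by (intro self.D_add differentiable_smooth x smooth_intros open_W Z f)
    moreover have "self.D (\<lambda>y. ?df v y *\<^sub>R Z y) x u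
        = frechet_derivative (?df v) (at x) u *\<^sub>R Z x + ?df v x *\<^sub>R self.D Z x u"
      by (intro self.D_scaleR differentiable_smooth x smooth_intros Z f)
    moreover have "self.D (\<lambda>y. f y *\<^sub>R self.D Z y v) x u
        = ?df u x *\<^sub>R self.D Z x v + f x *\<^sub>R self.D (\<lambda>y. self.D Z y v) x u"
      by (intro self.D_scaleR differentiable_smooth x smooth_intros Z f)
    ultimately show ?thesis by simp
  qed
  then show ?thesis
    by (simp add: ricci_commutator_def symmetric_second_derivative[OF f open_W x, of u v] algebra_simps)
qed

lemma ricci_commutator_sum:
  assumes x: "x \<in> W" and Z: "\<And>i. i \<in> I \<Longrightarrow> smooth_on W (Z i)"
  shows "ricci_commutator (\<lambda>y. \<Sum>i\<in>I. Z i y) x u v = (\<Sum>i\<in>I. ricci_commutator (Z i) x u v)"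
  using Z
proof (induction I rule: infinite_finite_induct)
  case (insert i I)
  then show ?case
    by (simp add: ricci_commutator_add[OF x] smooth_on_sum open_W)
qed (use ricci_commutator_scaleR[OF x, of "\<lambda>_. 0" "\<lambda>_. 0" u v] in \<open>simp_all add: smooth_on_const\<close>)

lemma riem_eq_ricci_commutator: "x \<in> W \<Longrightarrow> riem H x u v w = ricci_commutator (\<lambda>_. w) x u v"
  by (simp add: riem_eq ricci_commutator_def)

lemma riem_linear:
  assumes x: "x \<in> W"
  shows "riem H x u v (w + w') = riem H x u v w + riem H x u v w'"
    and "riem H x u v (c *\<^sub>R w) = c *\<^sub>R riem H x u v w"
  using ricci_commutator_add[OF x, of "\<lambda>_. w" "\<lambda>_. w'"] ricci_commutator_scaleR[OF x, of "\<lambda>_. c" "\<lambda>_. w"]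
  by (simp_all add: riem_eq_ricci_commutator[OF x] smooth_on_const)

text \<open>Expand \<open>Z\<close> in the constant coordinate fields and use that the commutator is linear over functions.\<close>

lemma ricci_identity:
  assumes x: "x \<in> W" and Z: "smooth_on W Z"
  shows "ricci_commutator Z x u v = riem H x u v (Z x)"
proof -
  have lin: "linear (riem H x u v)"
    by (rule linearI) (simp_all add: riem_linear[OF x])
  have "ricci_commutator Z x u v = ricci_commutator (\<lambda>y. \<Sum>b\<in>Basis. (Z y \<bullet> b) *\<^sub>R b) x u v"
    by (simp add: euclidean_representation)
  also have "\<dots> = (\<Sum>b\<in>Basis. (Z x \<bullet> b) *\<^sub>R riem H x u v b)"
    by (simp add: ricci_commutator_sum[OF x] ricci_commutator_scaleR[OF x] riem_eq_ricci_commutator[OF x]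
        smooth_on_scaleR smooth_on_inner smooth_on_const open_W Z)
  also have "\<dots> = riem H x u v (Z x)"
    by (rule linear_expand_Basis[OF lin, symmetric])
  finally show ?thesis .
qed

lemma riem_skew: "x \<in> W \<Longrightarrow> riem H x u v w = - riem H x v u w"
  by (simp add: riem_eq)

lemma riem_add_first:
  assumes x: "x \<in> W"
  shows "riem H x (u + u') v w = riem H x u v w + riem H x u' v w"
proof -
  have lin: "linear (self.D Z y)" if "y \<in> W" "smooth_on W Z" for y Z
    by (intro self.D_linear differentiable_smooth that)
  have "self.D (\<lambda>y. self.D (\<lambda>_. w) y (u + u')) x = self.D (\<lambda>y. self.D (\<lambda>_. w) y u + self.D (\<lambda>_. w) y u') x"
    by (rule self.D_cong[OF x])
      (auto intro!: differentiable_smooth x smooth_intros linear_add[OF lin])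
  then have "self.D (\<lambda>y. self.D (\<lambda>_. w) y (u + u')) x v
      = self.D (\<lambda>y. self.D (\<lambda>_. w) y u) x v + self.D (\<lambda>y. self.D (\<lambda>_. w) y u') x v"
    by (simp add: self.D_add x differentiable_smooth smooth_D_const smooth_on_const)
  then show ?thesis
    by (simp add: riem_eq[OF x] linear_add[OF lin[OF x]] smooth_D_const smooth_on_const)
qed

text \<open>As the torsion vanishes, \<open>\<nabla>\<^sub>v w = \<nabla>\<^sub>w v\<close> for constant fields, so the six iterated derivatives cancel in pairs.\<close>

lemma riem_bianchi:
  assumes x: "x \<in> W"
  shows "riem H x u v w + riem H x v w u + riem H x w u v = 0"
proof -
  have "self.D (\<lambda>y. self.D (\<lambda>_. w) y v) x u = self.D (\<lambda>y. self.D (\<lambda>_. v) y w) x u" for u v w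
    by (rule fun_cong, rule self.D_cong[OF x])
      (auto intro!: differentiable_smooth x self.smooth_christoffel_along smooth_on_const
        simp: pullback_cov_def christoffel_commute)
  from this[of w v u] this[of u w v] this[of v u w] show ?thesis
    by (simp add: riem_eq[OF x])
qed

text \<open>The second derivatives of the function \<open>g(w,z)\<close> are symmetric; computing them with metric compatibility, the mixed
  terms are symmetric by themselves and the rest is the claim.\<close>

lemma riem_metric_skew:
  assumes x: "x \<in> W"
  shows "g x (riem H x u v w) z = - g x w (riem H x u v z)"
proof -
  let ?W = "\<lambda>u y. self.D (\<lambda>_. w) y u" and ?Z = "\<lambda>u y. self.D (\<lambda>_. z) y u"
  have smooth_g: "smooth_on W (\<lambda>y. g y w z)"
    by (intro smooth_intros open_W smooth_H)
  have "frechet_derivative (\<lambda>y. frechet_derivative (\<lambda>y. g y w z) (at y) v) (at x) u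
      = (g x (self.D (?W v) x u) z + g x (?W v x) (?Z u x))
       + (g x (?W u x) (?Z v x) + g x w (self.D (?Z v) x u))" for u v
  proof -
    have "frechet_derivative (\<lambda>y. frechet_derivative (\<lambda>y. g y w z) (at y) v) (at x)
        = frechet_derivative (\<lambda>y. g y (?W v y) z + g y w (?Z v y)) (at x)"
      by (rule frechet_derivative_transform_within_open[OF _ open_W x])
        (auto intro!: differentiable_smooth[OF x] smooth_on_imp_differentiable[of W] smooth_on_frechet_derivative_const smooth_g x
           simp: self.derivative_g_along[of _ "\<lambda>_. w" "\<lambda>_. z"])
    moreover have "frechet_derivative (\<lambda>y. g y (?W v y) z + g y w (?Z v y)) (at x)
        = (\<lambda>u. frechet_derivative (\<lambda>y. g y (?W v y) z) (at x) u
         + frechet_derivative (\<lambda>y. g y w (?Z v y)) (at x) u)"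
      by (rule frechet_derivative_at[symmetric], rule has_derivative_add)
        (auto intro!: smooth_on_has_derivative[OF _ x] smooth_intros open_W smooth_H)
    moreover have "frechet_derivative (\<lambda>y. g y (?W v y) z) (at x) u
        = g x (self.D (?W v) x u) z + g x (?W v x) (?Z u x)"
      by (rule self.derivative_g_along[OF x])
        (auto intro!: differentiable_smooth[OF x] smooth_intros)
    moreover have "frechet_derivative (\<lambda>y. g y w (?Z v y)) (at x) u
        = g x (?W u x) (?Z v x) + g x w (self.D (?Z v) x u)"
      by (rule self.derivative_g_along[OF x])
        (auto intro!: differentiable_smooth[OF x] smooth_intros)
    ultimately show ?thesis by simp
  qed
  from this[of v u] this[of u v] show ?thesis
    using symmetric_second_derivative[OF smooth_g open_W x, of u v]
    by (simp add: riem_eq[OF x] inner_mat_simps)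
qed

end

section \<open>Covariant derivatives of an almost contact structure\<close>

locale contact_metric_domain = metric_domain W H
  for W :: "(real^'m) set" and H :: "real^'m \<Rightarrow> real^'m^'m" +
  fixes \<xi> \<eta> :: "real^'m \<Rightarrow> real^'m" and P :: "real^'m \<Rightarrow> real^'m^'m"
  assumes smooth_xi: "smooth_on W \<xi>" and smooth_P: "smooth_on W P"
    and contact: "x \<in> W \<Longrightarrow> contact_metric_space (H x) (\<xi> x) (\<eta> x) (P x)"
begin

lemma D_endo:
  assumes x: "x \<in> W" and Z: "Z differentiable (at x)"
  shows "self.D (\<lambda>y. P y *v Z y) x u = cov_deriv_endo H P x u (Z x) + P x *v self.D Z x u"
proof -
  have dP: "(P has_derivative frechet_derivative P (at x)) (at x)"
    by (rule smooth_on_has_derivative[OF smooth_P x])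
  have d: "frechet_derivative (\<lambda>y. P y *v Y y) (at x)
      = (\<lambda>u. P x *v frechet_derivative Y (at x) u + frechet_derivative P (at x) u *v Y x)"
    if "Y differentiable (at x)" for Y
    using frechet_derivative_at[OF bounded_bilinear.FDERIV[OF bounded_bilinear_matrix_vector_mult dP
        that[unfolded frechet_derivative_works]]] by simp
  have P0: "P x *v 0 = 0" by simp
  show ?thesis
    by (simp add: pullback_cov_def cov_deriv_endo_def cov_deriv_def d[OF Z] d[of "\<lambda>_. Z x"] P0
        matrix_vector_right_distrib)
qed

lemma D_xi_orthogonal:
  assumes x: "x \<in> W"
  shows "g x (self.D \<xi> x u) (\<xi> x) = 0"
proof -
  have "frechet_derivative (\<lambda>y. g y (\<xi> y) (\<xi> y)) (at x) u = frechet_derivative (\<lambda>y. 1 :: real) (at x) u"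
    by (rule fun_cong, rule frechet_derivative_transform_within_open[OF _ open_W x])
      (auto intro!: smooth_on_imp_differentiable[OF _ x] smooth_intros open_W smooth_H smooth_xi
        contact_metric_space.ip_xi_xi[OF contact])
  then show ?thesis
    using g_commute[OF x, of "\<xi> x"]
    by (simp add: self.derivative_g_along[OF x differentiable_smooth[OF x smooth_xi] differentiable_smooth[OF x smooth_xi]])
qed

text \<open>The field \<open>\<langle>A,w\<rangle>\<xi> - \<langle>w,\<xi>\<rangle>A\<close>, with \<open>A\<close> a vector field and \<open>w\<close> constant: the prescribed \<open>(\<nabla>\<^sub>v\<phi>)w\<close> is the combination of
  this field for \<open>A = v\<close> and for \<open>A = \<phi>v\<close>.\<close>

definition wedge_xi :: "(real^'m \<Rightarrow> real^'m) \<Rightarrow> real^'m \<Rightarrow> real^'m \<Rightarrow> real^'m" where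
  "wedge_xi A w y = g y (A y) w *\<^sub>R \<xi> y - g y w (\<xi> y) *\<^sub>R A y"

lemma smooth_wedge_xi: "smooth_on W A \<Longrightarrow> smooth_on W (wedge_xi A w)"
  unfolding wedge_xi_def[abs_def] by (intro smooth_intros open_W smooth_H smooth_xi)

lemma D_wedge_xi:
  assumes x: "x \<in> W" and A: "smooth_on W A"
  shows "self.D (wedge_xi A w) x u
    = (g x (self.D A x u) w + g x (A x) (self.D (\<lambda>_. w) x u)) *\<^sub>R \<xi> x + g x (A x) w *\<^sub>R self.D \<xi> x u
      - ((g x (self.D (\<lambda>_. w) x u) (\<xi> x) + g x w (self.D \<xi> x u)) *\<^sub>R A x + g x w (\<xi> x) *\<^sub>R self.D A x u)"
proof -
  have "self.D (\<lambda>y. g y (A y) w *\<^sub>R \<xi> y) x u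
      = frechet_derivative (\<lambda>y. g y (A y) w) (at x) u *\<^sub>R \<xi> x + g x (A x) w *\<^sub>R self.D \<xi> x u"
    by (intro self.D_scaleR differentiable_smooth[OF x] smooth_on_imp_differentiable[OF _ x] x
        smooth_intros A open_W smooth_H smooth_xi)
  moreover have "self.D (\<lambda>y. g y w (\<xi> y) *\<^sub>R A y) x u
      = frechet_derivative (\<lambda>y. g y w (\<xi> y)) (at x) u *\<^sub>R A x + g x w (\<xi> x) *\<^sub>R self.D A x u"
    by (intro self.D_scaleR differentiable_smooth[OF x] smooth_on_imp_differentiable[OF _ x] x
        smooth_intros A open_W smooth_H smooth_xi)
  moreover have "frechet_derivative (\<lambda>y. g y (A y) w) (at x) u
      = g x (self.D A x u) w + g x (A x) (self.D (\<lambda>_. w) x u)"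
    by (intro self.derivative_g_along x differentiable_smooth[OF x] A smooth_on_const)
  moreover have "frechet_derivative (\<lambda>y. g y w (\<xi> y)) (at x) u
      = g x (self.D (\<lambda>_. w) x u) (\<xi> x) + g x w (self.D \<xi> x u)"
    by (intro self.derivative_g_along x differentiable_smooth[OF x] smooth_xi smooth_on_const)
  moreover have "self.D (wedge_xi A w) x u
      = self.D (\<lambda>y. g y (A y) w *\<^sub>R \<xi> y) x u - self.D (\<lambda>y. g y w (\<xi> y) *\<^sub>R A y) x u"
    unfolding wedge_xi_def[abs_def]
    by (intro self.D_diff differentiable_smooth[OF x] x smooth_intros A open_W smooth_H smooth_xi)
  ultimately show ?thesis by simp
qed

end

text \<open>\<open>(a, b) = (1, 0)\<close> is the Sasakian condition, \<open>(0, 1)\<close> the Kenmotsu condition and \<open>(0, 0)\<close> the cosymplectic one;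
  structures with \<open>\<nabla>\<phi>\<close> of this form are known as trans-Sasakian.\<close>

locale trans_sasakian_domain = contact_metric_domain W H \<xi> \<eta> P
  for W :: "(real^'m) set" and H \<xi> \<eta> P +
  fixes a b :: real
  assumes ab: "a * b = 0"
    and nabla_phi: "x \<in> W \<Longrightarrow> cov_deriv_endo H P x X Y
      = a *\<^sub>R (g x X Y *\<^sub>R \<xi> x - (\<eta> x \<bullet> Y) *\<^sub>R X)
        + b *\<^sub>R (g x (P x *v X) Y *\<^sub>R \<xi> x - (\<eta> x \<bullet> Y) *\<^sub>R (P x *v X))"
begin

text \<open>Differentiate \<open>\<phi>\<xi> = 0\<close> to find \<open>\<phi>(\<nabla>\<^sub>u\<xi>) = - (\<nabla>\<^sub>u\<phi>)\<xi>\<close>, then apply \<open>\<phi>\<close>, which is invertible on the vectors orthogonal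
  to \<open>\<xi>\<close>; \<open>\<nabla>\<^sub>u\<xi>\<close> is such a vector because \<open>|\<xi>| = 1\<close>.\<close>

lemma D_xi:
  assumes x: "x \<in> W"
  shows "self.D \<xi> x u = - a *\<^sub>R (P x *v u) + b *\<^sub>R (u - g x u (\<xi> x) *\<^sub>R \<xi> x)"
proof -
  interpret C: contact_metric_space "H x" "\<xi> x" "\<eta> x" "P x" by (rule contact[OF x])
  have "self.D (\<lambda>y. P y *v \<xi> y) x = self.D (\<lambda>y. 0) x"
    by (rule self.D_cong[OF x])
      (auto intro!: differentiable_smooth[OF x] smooth_intros open_W smooth_P smooth_xi
        contact_metric_space.J_xi[OF contact])
  then have "self.D (\<lambda>y. P y *v \<xi> y) x u = 0"
    using christoffel_simps(4)[OF x, of u 0 0] by (simp add: pullback_cov_def)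
  then have "C.J (self.D \<xi> x u) = - cov_deriv_endo H P x u (\<xi> x)"
    by (simp add: D_endo[OF x differentiable_smooth[OF x smooth_xi]] eq_neg_iff_add_eq_0 add.commute)
  then have J: "C.J (self.D \<xi> x u) = a *\<^sub>R u - (a * g x u (\<xi> x)) *\<^sub>R \<xi> x + b *\<^sub>R C.J u"
    by (simp add: nabla_phi[OF x] C.eta_eq C.ip_xi_xi C.ip_J_xi algebra_simps)
  have "self.D \<xi> x u = - C.J (C.J (self.D \<xi> x u))"
    by (simp add: C.J_J D_xi_orthogonal[OF x])
  also have "\<dots> = - a *\<^sub>R (P x *v u) + b *\<^sub>R (u - g x u (\<xi> x) *\<^sub>R \<xi> x)"
    by (simp only: J C.J_simps C.J_J C.J_xi) (simp add: algebra_simps)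
  finally show ?thesis .
qed

text \<open>The Ricci identity for the tensor \<open>\<phi>\<close>: the commutator \<open>[R(u,v), \<phi>]\<close> is the antisymmetrized second covariant
  derivative of \<open>\<phi>\<close>, which is computed by differentiating the prescribed formula for \<open>\<nabla>\<phi>\<close> once more. The right-hand side is
  the same commutator for a space of constant curvature \<open>a\<^sup>2 - b\<^sup>2\<close>.\<close>

lemma riem_phi_commutator:
  assumes x: "x \<in> W"
  shows "riem H x u v (P x *v w) - P x *v riem H x u v w
    = (a\<^sup>2 - b\<^sup>2) *\<^sub>R (R1star (g x) u v (P x *v w) - P x *v R1star (g x) u v w)"
proof -
  interpret C: contact_metric_space "H x" "\<xi> x" "\<eta> x" "P x" by (rule contact[OF x])
  define Q where "Q u z = a *\<^sub>R (g x u z *\<^sub>R \<xi> x - g x z (\<xi> x) *\<^sub>R u)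
      + b *\<^sub>R (g x (C.J u) z *\<^sub>R \<xi> x - g x z (\<xi> x) *\<^sub>R C.J u)" for u z
  have endo: "cov_deriv_endo H P x u z = Q u z" for u z
    by (simp add: nabla_phi[OF x] Q_def C.eta_eq)
  let ?nabla = "\<lambda>u v. self.D (\<lambda>_. v) x u"
  have sm: "smooth_on W (\<lambda>y. P y *v v)" for v
    by (intro smooth_intros open_W smooth_P)
  have first: "self.D (\<lambda>y. P y *v w) y v
      = (a *\<^sub>R wedge_xi (\<lambda>_. v) w y + b *\<^sub>R wedge_xi (\<lambda>y. P y *v v) w y) + P y *v self.D (\<lambda>_. w) y v"
    if y: "y \<in> W" for y v
    using D_endo[OF y, of "\<lambda>_. w" v]
    by (simp add: nabla_phi[OF y] wedge_xi_def contact_metric_space.eta_eq[OF contact[OF y]])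
  have second: "self.D (\<lambda>y. self.D (\<lambda>y. P y *v w) y v) x u
      = (a *\<^sub>R self.D (wedge_xi (\<lambda>_. v) w) x u + b *\<^sub>R self.D (wedge_xi (\<lambda>y. P y *v v) w) x u)
        + (Q u (?nabla v w) + C.J (self.D (\<lambda>y. self.D (\<lambda>_. w) y v) x u))" for u v
  proof -
    have "self.D (\<lambda>y. self.D (\<lambda>y. P y *v w) y v) x
        = self.D (\<lambda>y. (a *\<^sub>R wedge_xi (\<lambda>_. v) w y + b *\<^sub>R wedge_xi (\<lambda>y. P y *v v) w y)
            + P y *v self.D (\<lambda>_. w) y v) x"
      by (rule self.D_cong[OF x]) (auto intro!: differentiable_smooth[OF x] smooth_intros sm first)
    moreover have "self.D (\<lambda>y. (a *\<^sub>R wedge_xi (\<lambda>_. v) w y + b *\<^sub>R wedge_xi (\<lambda>y. P y *v v) w y)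
            + P y *v self.D (\<lambda>_. w) y v) x u
        = self.D (\<lambda>y. a *\<^sub>R wedge_xi (\<lambda>_. v) w y + b *\<^sub>R wedge_xi (\<lambda>y. P y *v v) w y) x u
            + self.D (\<lambda>y. P y *v self.D (\<lambda>_. w) y v) x u"
      by (intro self.D_add differentiable_smooth[OF x] x smooth_intros open_W smooth_P smooth_wedge_xi)
    moreover have "self.D (\<lambda>y. a *\<^sub>R wedge_xi (\<lambda>_. v) w y + b *\<^sub>R wedge_xi (\<lambda>y. P y *v v) w y) x u
        = self.D (\<lambda>y. a *\<^sub>R wedge_xi (\<lambda>_. v) w y) x u + self.D (\<lambda>y. b *\<^sub>R wedge_xi (\<lambda>y. P y *v v) w y) x u"
      by (intro self.D_add differentiable_smooth[OF x] x smooth_intros open_W smooth_P smooth_wedge_xi)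
    moreover have "self.D (\<lambda>y. a *\<^sub>R wedge_xi (\<lambda>_. v) w y) x u = a *\<^sub>R self.D (wedge_xi (\<lambda>_. v) w) x u"
      by (intro self.D_scaleR_const differentiable_smooth[OF x] x smooth_intros smooth_wedge_xi)
    moreover have "self.D (\<lambda>y. b *\<^sub>R wedge_xi (\<lambda>y. P y *v v) w y) x u = b *\<^sub>R self.D (wedge_xi (\<lambda>y. P y *v v) w) x u"
      by (intro self.D_scaleR_const differentiable_smooth[OF x] x sm smooth_wedge_xi)
    moreover have "self.D (\<lambda>y. P y *v self.D (\<lambda>_. w) y v) x u
        = Q u (?nabla v w) + C.J (self.D (\<lambda>y. self.D (\<lambda>_. w) y v) x u)"
      using D_endo[OF x differentiable_smooth[OF x smooth_D_const[OF smooth_on_const[of W w]]], of v u]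
      by (simp add: endo)
    ultimately show ?thesis by simp
  qed
  have nabla_Pv: "self.D (\<lambda>y. P y *v v) x u = Q u v + C.J (?nabla u v)" for u v
    using D_endo[OF x, of "\<lambda>_. v" u] by (simp add: endo)
  \<comment> \<open>This is why the derivatives of the constant fields \<open>u\<close> and \<open>v\<close> drop out after antisymmetrization.\<close>
  have torsion: "?nabla v u = ?nabla u v"
    by (simp add: pullback_cov_def christoffel_commute[OF x, of u v])
  have R: "riem H x u v (C.J w) - C.J (riem H x u v w)
      = (a *\<^sub>R self.D (wedge_xi (\<lambda>_. v) w) x u + b *\<^sub>R self.D (wedge_xi (\<lambda>y. P y *v v) w) x u + Q u (?nabla v w))
      - (a *\<^sub>R self.D (wedge_xi (\<lambda>_. u) w) x v + b *\<^sub>R self.D (wedge_xi (\<lambda>y. P y *v u) w) x v + Q v (?nabla u w))"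
    by (simp only: ricci_identity[OF x sm, of w u v, symmetric] ricci_commutator_def second
        riem_eq[OF x, of u v w] C.J_simps) (simp add: algebra_simps)
  show ?thesis
  proof (rule g_eqI[OF x])
    fix z
    \<comment> \<open>Bring every inner product into a fixed order of its arguments, so that both sides become polynomials in the
      same variables.\<close>
    have swap: "C.ip v u = C.ip u v" "C.ip w u = C.ip u w" "C.ip w v = C.ip v w"
        "C.ip v (C.J u) = - C.ip u (C.J v)" "C.ip w (C.J u) = - C.ip u (C.J w)" "C.ip w (C.J v) = - C.ip v (C.J w)"
      by (rule C.ip_commute C.ip_J_swap)+
    have xi: "C.ip (\<xi> x) u = C.ip u (\<xi> x)" for u by (rule C.ip_commute)
    have "a = 0 \<or> b = 0" using ab by simp
    then show "C.ip (riem H x u v (C.J w) - C.J (riem H x u v w)) z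
      = C.ip ((a\<^sup>2 - b\<^sup>2) *\<^sub>R (R1star C.ip u v (C.J w) - C.J (R1star C.ip u v w))) z"
      by (auto simp: R D_wedge_xi[OF x] sm smooth_on_const D_xi[OF x] nabla_Pv torsion Q_def R1star_def
          inner_mat_simps C.J_simps C.J_J C.J_xi C.ip_J_left C.ip_J_xi C.ip_J_self C.ip_xi_xi swap xi power2_eq_square algebra_simps)
  qed
qed

end

section \<open>Space forms\<close>

context trans_sasakian_domain
begin

text \<open>Subtract the claimed expression from the curvature. The difference \<open>T\<close> is an algebraic curvature tensor, commutes
  with \<open>\<phi>\<close> since \<open>R\<^sub>1\<^sup>\<star> + R\<^sub>2\<^sup>\<star> + R\<^sub>3\<^sup>\<star>\<close> does and \<open>R\<close>, \<open>\<kappa> R\<^sub>1\<^sup>\<star>\<close> have the same commutator with \<open>\<phi>\<close>, and its holomorphic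
  sectional curvatures vanish. Commuting with \<open>\<phi>\<close> forces \<open>T(u,v)\<xi> = 0\<close>, so horizontal vectors suffice for the last point.\<close>

lemma space_form_curvature:
  assumes x: "x \<in> W"
    and c: "\<And>X. X \<noteq> 0 \<Longrightarrow> g x X (\<xi> x) = 0 \<Longrightarrow> sectional_curv H x X (P x *v X) = c"
  shows "riem H x u v w = ((c + 3 * (a\<^sup>2 - b\<^sup>2)) / 4) *\<^sub>R R1star (g x) u v w
      + ((c - (a\<^sup>2 - b\<^sup>2)) / 4) *\<^sub>R R2star (g x) (\<xi> x) (\<lambda>u. \<eta> x \<bullet> u) u v w
      + ((c - (a\<^sup>2 - b\<^sup>2)) / 4) *\<^sub>R R3star (g x) (\<lambda>u. P x *v u) u v w"
proof -
  interpret C: contact_metric_space "H x" "\<xi> x" "\<eta> x" "P x" by (rule contact[OF x])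
  define \<kappa> q where "\<kappa> = a\<^sup>2 - b\<^sup>2" and "q = (c - \<kappa>) / 4"
  define K where "K u v w = (\<kappa> + q) *\<^sub>R R1star (g x) u v w
      + q *\<^sub>R R2star (g x) (\<xi> x) (\<lambda>u. \<eta> x \<bullet> u) u v w + q *\<^sub>R R3star (g x) (\<lambda>u. P x *v u) u v w" for u v w
  note K_simps = K_def R1star_def R2star_def R3star_def Let_def C.eta_eq inner_mat_simps C.J_simps C.J_J C.J_xi
    C.ip_J_left C.ip_J_xi C.ip_J_self C.ip_xi_xi
  \<comment> \<open>\<open>K\<close> is \<open>\<kappa> R\<^sub>1\<^sup>\<star> + q (R\<^sub>1\<^sup>\<star> + R\<^sub>2\<^sup>\<star> + R\<^sub>3\<^sup>\<star>)\<close>, of holomorphic sectional curvature \<open>\<kappa> + 4 q = c\<close>.\<close>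
  define T where "T u v w z = g x (riem H x u v w - K u v w) z" for u v w z
  have swaps: "C.ip v u = C.ip u v \<and> C.ip w u = C.ip u w \<and> C.ip w v = C.ip v w \<and>
      C.ip z u = C.ip u z \<and> C.ip z v = C.ip v z \<and> C.ip z w = C.ip w z \<and>
      C.ip v (C.J u) = - C.ip u (C.J v) \<and> C.ip w (C.J u) = - C.ip u (C.J w) \<and> C.ip w (C.J v) = - C.ip v (C.J w) \<and>
      C.ip z (C.J u) = - C.ip u (C.J z) \<and> C.ip z (C.J v) = - C.ip v (C.J z) \<and> C.ip z (C.J w) = - C.ip w (C.J z) \<and>
      C.ip (\<xi> x) u = C.ip u (\<xi> x) \<and> C.ip (\<xi> x) v = C.ip v (\<xi> x) \<and> C.ip (\<xi> x) w = C.ip w (\<xi> x) \<and> C.ip (\<xi> x) z = C.ip z (\<xi> x)" for u v w z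
    by (intro conjI; rule C.ip_commute C.ip_J_swap)
  have T_add: "T (u + u') v w z = T u v w z + T u' v w z" for u u' v w z
    by (simp add: T_def riem_add_first[OF x] inner_mat_simps)
       (simp add: K_simps algebra_simps)
  have T_skew12: "T u v w z = - T v u w z" for u v w z
  proof -
    have "K u v w = - K v u w"
      by (simp add: K_simps C.ip_J_swap[of v u] algebra_simps)
    then show ?thesis
      by (simp add: T_def riem_skew[OF x, of u v] inner_mat_simps)
  qed
  have T_skew34: "T u v w z = - T u v z w" for u v w z
  proof -
    have "C.ip (K u v w) z = - C.ip (K u v z) w"
      by (simp add: K_simps swaps[of v u w z] algebra_simps)
    then show ?thesis
      using riem_metric_skew[OF x, of u v w z] C.ip_commute[of w]
      by (simp add: T_def inner_mat_simps)
  qed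
  have T_bianchi: "T u v w z + T v w u z + T w u v z = 0" for u v w z
  proof -
    have "C.ip (K u v w + K v w u + K w u v) z = 0"
      by (simp only: K_simps) (simp add: swaps[of v u w z] algebra_simps)
    then have "C.ip (riem H x u v w + riem H x v w u + riem H x w u v - (K u v w + K v w u + K w u v)) z = 0"
      by (simp add: riem_bianchi[OF x] inner_mat_simps)
    then show ?thesis by (simp add: T_def inner_mat_simps)
  qed
  have T_J: "T u v (C.J w) z = - T u v w (C.J z)" for u v w z
  proof -
    have "K u v (C.J w) - C.J (K u v w) = \<kappa> *\<^sub>R (R1star (g x) u v (C.J w) - C.J (R1star (g x) u v w))"
      by (simp add: K_simps swaps[of v u w w] algebra_simps)
    then have "riem H x u v (C.J w) - C.J (riem H x u v w) = K u v (C.J w) - C.J (K u v w)"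
      by (simp only: riem_phi_commutator[OF x] \<kappa>_def)
    then have "riem H x u v (C.J w) - K u v (C.J w) = C.J (riem H x u v w - K u v w)"
      by (simp add: C.J_simps algebra_simps)
    then show ?thesis by (simp add: T_def C.ip_J_left)
  qed
  have T_linear4: "T u v w (z + z') = T u v w z + T u v w z'" "T u v w (d *\<^sub>R z) = d * T u v w z"
    "T u v w (- z) = - T u v w z" for u v w z z' d
    by (simp_all add: T_def inner_mat_simps)
  have T_linear3: "T u v (w + w') z = T u v w z + T u v w' z" "T u v (d *\<^sub>R w) z = d * T u v w z"
    "T u v (- w) z = - T u v w z" for u v w w' z d
    using T_skew34[of u v w z] T_skew34[of u v w' z] T_skew34[of u v "w + w'" z] T_skew34[of u v "d *\<^sub>R w" z]
      T_skew34[of u v "- w" z] by (simp_all add: T_linear4)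
  \<comment> \<open>\<open>T(u,v)\<xi>\<close> is orthogonal to the image of \<open>\<phi>\<close> because \<open>\<phi>\<xi> = 0\<close>, and to \<open>\<xi>\<close> by skew symmetry.\<close>
  have T_xi: "T u v (\<xi> x) z = 0" for u v z
  proof -
    have "z = - C.J (C.J z) + g x z (\<xi> x) *\<^sub>R \<xi> x" by (simp add: C.J_J)
    then have "T u v (\<xi> x) z = - T u v (\<xi> x) (C.J (C.J z)) + g x z (\<xi> x) * T u v (\<xi> x) (\<xi> x)"
      by (metis T_linear4)
    moreover have "T u v (\<xi> x) (C.J (C.J z)) = 0"
      using T_J[of u v "\<xi> x" "C.J z"] T_linear3(2)[of u v 0 0] by (simp add: C.J_xi)
    ultimately show ?thesis using T_skew34[of u v "\<xi> x" "\<xi> x"] by simp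
  qed
  have T_xi2: "T u v w (\<xi> x) = 0" for u v w
    using T_skew34[of u v w "\<xi> x"] T_xi by simp
  have T_JJ: "T u v (C.J (C.J w)) z = - T u v w z" for u v w z
    unfolding C.J_J by (simp only: T_linear3 T_xi)
  have T_holomorphic_horizontal: "T X (C.J X) (C.J X) X = 0" if "C.ip X (\<xi> x) = 0" for X
  proof (cases "X = 0")
    case True
    then show ?thesis by (simp add: T_def inner_mat_simps)
  next
    case False
    have "C.ip X X \<noteq> 0" using False g_eq_0_iff[OF x] by simp
    moreover have "C.ip (C.J X) (C.J X) = C.ip X X"
      by (simp add: C.phi_isometric C.eta_eq that)
    ultimately have "C.ip (riem H x X (C.J X) (C.J X)) X = c * (C.ip X X * C.ip X X)"
      using c[OF False that] by (simp add: sectional_curv_def C.ip_J_self field_simps)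
    moreover have "C.ip (K X (C.J X) (C.J X)) X = (\<kappa> + 4 * q) * (C.ip X X * C.ip X X)"
      by (simp only: K_simps) (simp add: that C.ip_J_left C.ip_commute[of "\<xi> x"] algebra_simps)
    moreover have "\<kappa> + 4 * q = c" by (simp add: q_def field_simps)
    ultimately show ?thesis by (simp add: T_def inner_mat_simps)
  qed
  \<comment> \<open>Subtracting the \<open>\<xi>\<close>-component of \<open>X\<close> changes neither \<open>\<phi>X\<close> nor the value of \<open>T\<close>.\<close>
  have T_holomorphic: "T X (C.J X) (C.J X) X = 0" for X
  proof -
    define Y where "Y = X + (- g x X (\<xi> x)) *\<^sub>R \<xi> x"
    have Y: "C.ip Y (\<xi> x) = 0" "C.J Y = C.J X" "X = Y + g x X (\<xi> x) *\<^sub>R \<xi> x"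
      by (simp_all add: Y_def inner_mat_simps C.ip_xi_xi C.J_simps C.J_xi)
    have T_xi_first: "T (d *\<^sub>R \<xi> x) v w z = 0" for d v w z
      using curvature_pair_symmetric[of T, OF T_skew12 T_skew34 T_bianchi, of "d *\<^sub>R \<xi> x" v w z]
        T_xi[of w z v] by (simp add: T_linear3)
    have "T X (C.J X) (C.J X) X = T (Y + g x X (\<xi> x) *\<^sub>R \<xi> x) (C.J Y) (C.J Y) (Y + g x X (\<xi> x) *\<^sub>R \<xi> x)"
      using Y by simp
    also have "\<dots> = T Y (C.J Y) (C.J Y) Y"
      by (simp add: T_add T_xi_first T_linear4 T_xi2)
    also have "\<dots> = 0" by (rule T_holomorphic_horizontal[OF Y(1)])
    finally show ?thesis .
  qed
  have "T u v w z = 0" for z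
    by (rule kaehler_curvature_eq_0[of T "C.J"])
      (rule T_add T_skew12 T_skew34 T_bianchi C.J_simps T_J T_JJ T_holomorphic)+
  then have "riem H x u v w = K u v w"
    by (intro g_eqI[OF x]) (simp add: T_def inner_mat_simps)
  moreover have "\<kappa> + q = (c + 3 * \<kappa>) / 4" by (simp add: q_def field_simps)
  ultimately show ?thesis by (simp add: K_def q_def \<kappa>_def)
qed

end

lemma riemannian_manifold_chart:
  assumes "riemannian_manifold N" "D \<in> atlas N"
  shows "metric_domain (chart_image D) (metric N D)"
  using assms by unfold_locales (auto simp: riemannian_manifold_def smooth_manifold_def)

lemma almost_contact_chart:
  assumes N: "almost_contact_metric_manifold N" and D: "D \<in> atlas N"
  shows "contact_metric_domain (chart_image D) (metric N D) (xi N D) (eta N D) (phi N D)"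
proof -
  have "riemannian_manifold N"
    using N by (simp add: almost_contact_metric_manifold_def)
  then interpret metric_domain "chart_image D" "metric N D"
    using D by (rule riemannian_manifold_chart)
  show ?thesis
  proof (intro contact_metric_domain.intro contact_metric_domain_axioms.intro metric_domain_axioms)
    show "smooth_on (chart_image D) (xi N D)" "smooth_on (chart_image D) (phi N D)"
      using N D by (auto simp: almost_contact_metric_manifold_def)
    show "contact_metric_space (metric N D x) (xi N D x) (eta N D x) (phi N D x)"
      if x: "x \<in> chart_image D" for x
      using N D x transpose_H[OF x] pos[OF x]
      unfolding almost_contact_metric_manifold_def Let_def contact_metric_space_def by blast
  qed
qed

lemma trans_sasakian_space_form:
  assumes N: "almost_contact_metric_manifold N" and ab: "a * b = 0"
    and nabla: "\<And>C x X Y. C \<in> atlas N \<Longrightarrow> x \<in> chart_image C \<Longrightarrow>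
       cov_deriv_endo (metric N C) (phi N C) x X Y
        = a *\<^sub>R (inner_mat (metric N C x) X Y *\<^sub>R xi N C x - (eta N C x \<bullet> Y) *\<^sub>R X)
          + b *\<^sub>R (inner_mat (metric N C x) (phi N C x *v X) Y *\<^sub>R xi N C x
              - (eta N C x \<bullet> Y) *\<^sub>R (phi N C x *v X))"
    and c: "constant_phi_sectional_curvature N c"
  shows "generalized_sasakian_space_form N (\<lambda>_. (c + 3 * (a\<^sup>2 - b\<^sup>2)) / 4)
    (\<lambda>_. (c - (a\<^sup>2 - b\<^sup>2)) / 4) (\<lambda>_. (c - (a\<^sup>2 - b\<^sup>2)) / 4)"
  unfolding generalized_sasakian_space_form_def Let_def
proof (intro conjI N ballI allI)
  fix C p X Y Z assume C: "C \<in> atlas N" and p: "p \<in> fst C"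
  interpret contact_metric_domain "chart_image C" "metric N C" "xi N C" "eta N C" "phi N C"
    by (rule almost_contact_chart[OF N C])
  interpret trans_sasakian_domain "chart_image C" "metric N C" "xi N C" "eta N C" "phi N C" a b
    by unfold_locales (auto simp: ab nabla[OF C])
  have x: "snd C p \<in> chart_image C" using p by (simp add: chart_image_def)
  show "riem (metric N C) (snd C p) X Y Z = ((c + 3 * (a\<^sup>2 - b\<^sup>2)) / 4) *\<^sub>R R1star (g (snd C p)) X Y Z
      + ((c - (a\<^sup>2 - b\<^sup>2)) / 4) *\<^sub>R R2star (g (snd C p)) (xi N C (snd C p)) (\<lambda>u. eta N C (snd C p) \<bullet> u) X Y Z
      + ((c - (a\<^sup>2 - b\<^sup>2)) / 4) *\<^sub>R R3star (g (snd C p)) (\<lambda>u. phi N C (snd C p) *v u) X Y Z"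
    by (rule space_form_curvature[OF x]) (use c C x in \<open>auto simp: constant_phi_sectional_curvature_def\<close>)
qed

lemma sasakian_space_form_curvature:
  assumes "sasakian_space_form N c"
  shows "generalized_sasakian_space_form N (\<lambda>_. (c + 3) / 4) (\<lambda>_. (c - 1) / 4) (\<lambda>_. (c - 1) / 4)"
  using trans_sasakian_space_form[of N 1 0 c] assms
  by (simp add: sasakian_space_form_def sasakian_def)

text \<open>The Kenmotsu condition is written with \<open>- \<langle>X, \<phi>Y\<rangle>\<close> in place of \<open>\<langle>\<phi>X, Y\<rangle>\<close>; the two agree because \<open>\<phi>\<close> is skew.\<close>

lemma kenmotsu_space_form_curvature:
  assumes "kenmotsu_space_form N c"
  shows "generalized_sasakian_space_form N (\<lambda>_. (c - 3) / 4) (\<lambda>_. (c + 1) / 4) (\<lambda>_. (c + 1) / 4)"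
proof -
  have N: "almost_contact_metric_manifold N"
    using assms by (simp add: kenmotsu_space_form_def kenmotsu_def)
  have "inner_mat (metric N C x) X (phi N C x *v Y) = - inner_mat (metric N C x) (phi N C x *v X) Y"
    if "C \<in> atlas N" "x \<in> chart_image C" for C x X Y
    using contact_metric_space.ip_J_left[OF contact_metric_domain.contact[OF almost_contact_chart[OF N that(1)] that(2)]]
    by simp
  then show ?thesis
    using trans_sasakian_space_form[of N 0 1 c] assms N
    by (simp add: kenmotsu_space_form_def kenmotsu_def)
qed

lemma cosymplectic_space_form_curvature:
  assumes "cosymplectic_space_form N c"
  shows "generalized_sasakian_space_form N (\<lambda>_. c / 4) (\<lambda>_. c / 4) (\<lambda>_. c / 4)"
  using trans_sasakian_space_form[of N 0 0 c] assms
  by (simp add: cosymplectic_space_form_def cosymplectic_def)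

section \<open>Hypersurfaces in charts\<close>

definition patch :: "('a, 'n::finite) chart \<Rightarrow> ('b, 'm::finite) chart \<Rightarrow> ('a \<Rightarrow> 'b) \<Rightarrow> (real^'n) set" where
  "patch C D \<psi> = snd C ` (fst C \<inter> \<psi> -` fst D)"

lemma chart_inj:
  assumes "smooth_manifold M" "C \<in> atlas M"
  shows "inj_on (snd C) (fst C)"
proof -
  have "homeomorphic_map (subtopology (mfd_top M) (fst C)) (top_of_set (chart_image C)) (snd C)"
    and "openin (mfd_top M) (fst C)"
    using assms by (auto simp: smooth_manifold_def)
  then show ?thesis
    using homeomorphic_imp_injective_map openin_subset
    by (fastforce simp: inf_absorb2)
qed

lemma open_patch:
  assumes M: "smooth_manifold M" and N: "smooth_manifold N" and psi: "continuous_map (mfd_top M) (mfd_top N) \<psi>"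
    and C: "C \<in> atlas M" and D: "D \<in> atlas N"
  shows "open (patch C D \<psi>)"
proof -
  have hom: "homeomorphic_map (subtopology (mfd_top M) (fst C)) (top_of_set (chart_image C)) (snd C)"
    and oC: "openin (mfd_top M) (fst C)" and oI: "open (chart_image C)"
    using M C by (auto simp: smooth_manifold_def)
  have oD: "openin (mfd_top N) (fst D)"
    using N D by (auto simp: smooth_manifold_def)
  have "openin (mfd_top M) {p \<in> topspace (mfd_top M). \<psi> p \<in> fst D}"
    by (rule openin_continuous_map_preimage[OF psi oD])
  then have "openin (mfd_top M) (fst C \<inter> {p \<in> topspace (mfd_top M). \<psi> p \<in> fst D})"
    by (rule openin_Int[OF oC])
  also have "fst C \<inter> {p \<in> topspace (mfd_top M). \<psi> p \<in> fst D} = fst C \<inter> \<psi> -` fst D"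
    using openin_subset[OF oC] by auto
  finally have "openin (subtopology (mfd_top M) (fst C)) (fst C \<inter> \<psi> -` fst D)"
    by (simp add: openin_open_subtopology[OF oC])
  then have "openin (top_of_set (chart_image C)) (patch C D \<psi>)"
    using homeomorphic_imp_open_map[OF hom] by (simp add: patch_def open_map_def)
  then show ?thesis using oI by (simp add: openin_open_eq)
qed

text \<open>Passage from manifolds to coordinates: on the part of a chart of \<open>M\<close> that \<open>\<psi>\<close> maps into a given chart of \<open>N\<close>, the
  global notions become those of a single isometric immersion between coordinate domains.\<close>

lemma hypersurface_patch:
  assumes hyp: "hypersurface M N \<psi>" and C: "C \<in> atlas M" and D: "D \<in> atlas N"
  shows "isometric_patch (chart_image D) (metric N D) (patch C D \<psi>) (coord_rep C D \<psi>) (metric M C)"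
    and "p \<in> fst C \<Longrightarrow> \<psi> p \<in> fst D \<Longrightarrow> coord_rep C D \<psi> (snd C p) = snd D (\<psi> p)"
proof -
  have M: "riemannian_manifold M" and N: "riemannian_manifold N" and iso: "isometric_immersion M N \<psi>"
    using hyp by (auto simp: hypersurface_def)
  have sM: "smooth_manifold M" and sN: "smooth_manifold N"
    using M N by (auto simp: riemannian_manifold_def)
  have smooth: "smooth_map M N \<psi>" using iso by (simp add: isometric_immersion_def)
  have op: "open (patch C D \<psi>)"
    using open_patch[OF sM sN _ C D] smooth by (simp add: smooth_map_def)
  show rep: "coord_rep C D \<psi> (snd C p) = snd D (\<psi> p)" if "p \<in> fst C" for p
    using that inv_into_f_f[OF chart_inj[OF sM C]] by (simp add: coord_rep_def chart_inv_def)
  interpret target: metric_domain "chart_image D" "metric N D"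
    by (rule riemannian_manifold_chart[OF N D])
  interpret M: metric_domain "chart_image C" "metric M C"
    by (rule riemannian_manifold_chart[OF M C])
  have sub: "patch C D \<psi> \<subseteq> chart_image C"
    by (auto simp: patch_def chart_image_def)
  show "isometric_patch (chart_image D) (metric N D) (patch C D \<psi>) (coord_rep C D \<psi>) (metric M C)"
  proof unfold_locales
    show "smooth_on (patch C D \<psi>) (coord_rep C D \<psi>)"
      using smooth C D by (simp add: smooth_map_def patch_def)
    show "smooth_on (patch C D \<psi>) (metric M C)"
      by (rule smooth_on_subset[OF M.smooth_H sub])
  next
    fix x assume "x \<in> patch C D \<psi>"
    then obtain p where p: "p \<in> fst C" "\<psi> p \<in> fst D" "x = snd C p"
      by (auto simp: patch_def)
    then have "(C, D, p) \<in> adapted_charts M N \<psi>"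
      using C D by (simp add: adapted_charts_def)
    then show "inner_mat (metric N D (coord_rep C D \<psi> x))
         (frechet_derivative (coord_rep C D \<psi>) (at x) u) (frechet_derivative (coord_rep C D \<psi>) (at x) v)
        = inner_mat (metric M C x) u v" for u v
      using iso p rep[OF p(1)] by (fastforce simp: isometric_immersion_def map_deriv_def)
    show "coord_rep C D \<psi> x \<in> chart_image D"
      using p rep by (simp add: chart_image_def)
  qed (use op sub M.transpose_H M.pos in auto)
qed

text \<open>Work in charts around a point with nonzero tension. The hypothesis on the mean curvature makes the length of the
  tension field constant in a whole neighbourhood, as the twofold differentiation of \<open>|\<tau>|\<^sup>2\<close> requires.\<close>

theorem no_proper_biharmonic_cmc_hypersurface:
  fixes M :: "('a, 'n::finite) riemannian" and N :: "('b, 'm::finite) contact_metric"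
  assumes gssf: "generalized_sasakian_space_form N f1 f2 f3"
    and le: "\<And>q. q \<in> topspace (mfd_top N) \<Longrightarrow> real CARD('n) * f1 q - f2 q + 3 * f3 q \<le> 0"
    and hyp: "hypersurface M N \<psi>" and xi: "xi_tangent M N \<psi>" and cmc: "constant_mean_curvature M N \<psi>"
  shows "\<not> proper_biharmonic M N \<psi>"
proof
  assume proper: "proper_biharmonic M N \<psi>"
  then obtain C D p where Cp: "(C, D, p) \<in> adapted_charts M N \<psi>"
    and nz: "tension (metric M C) (metric N D) (coord_rep C D \<psi>) (snd C p) \<noteq> 0"
    by (auto simp: proper_biharmonic_def harmonic_map_def)
  then have C: "C \<in> atlas M" and D: "D \<in> atlas N" and p: "p \<in> fst C" "\<psi> p \<in> fst D"
    by (auto simp: adapted_charts_def)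
  have N: "almost_contact_metric_manifold N"
    using gssf by (simp add: generalized_sasakian_space_form_def)
  define F where "F = coord_rep C D \<psi>"
  interpret contact_metric_domain "chart_image D" "metric N D" "xi N D" "eta N D" "phi N D"
    by (rule almost_contact_chart[OF N D])
  interpret isometric_patch "chart_image D" "metric N D" "patch C D \<psi>" F "metric M C"
    unfolding F_def by (rule hypersurface_patch(1)[OF hyp C D])
  have F: "F (snd C q) = snd D (\<psi> q)" if "q \<in> fst C" "\<psi> q \<in> fst D" for q
    unfolding F_def by (rule hypersurface_patch(2)[OF hyp C D that])
  have x: "snd C p \<in> patch C D \<psi>" using p by (auto simp: patch_def)
  obtain h where h: "\<And>C D p. (C, D, p) \<in> adapted_charts M N \<psi> \<Longrightarrow>
      sqrt (inner_mat (metric N D (snd D (\<psi> p)))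
        (mean_curv (metric M C) (metric N D) (coord_rep C D \<psi>) (snd C p))
        (mean_curv (metric M C) (metric N D) (coord_rep C D \<psi>) (snd C p))) = h"
    using cmc unfolding constant_mean_curvature_def Let_def by blast
  have const: "g (F y) (\<tau> y) (\<tau> y) = (real CARD('n) * h)\<^sup>2" if y: "y \<in> patch C D \<psi>" for y
  proof -
    obtain q where q: "q \<in> fst C" "\<psi> q \<in> fst D" "y = snd C q"
      using y by (auto simp: patch_def)
    define m where "m = mean_curv (metric M C) (metric N D) F y"
    have "(C, D, q) \<in> adapted_charts M N \<psi>"
      using C D q by (simp add: adapted_charts_def)
    then have "sqrt (g (F y) m m) = h"
      using h q F[OF q(1,2)] by (simp add: m_def F_def)
    then have "g (F y) m m = h\<^sup>2"
      using g_nonneg[OF F_in_W[OF y]] by auto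
    moreover have "\<tau> y = real CARD('n) *\<^sub>R m"
      by (simp add: m_def mean_curv_def tension_def)
    ultimately show ?thesis
      by (simp add: inner_mat_simps power2_eq_square)
  qed
  have "\<tau> (snd C p) = 0"
  proof (rule constant_length_biharmonic_imp_harmonic[OF x _ const])
    show "CARD('m) = CARD('n) + 1"
      using hyp by (simp add: hypersurface_def)
    show "bitension (metric M C) (metric N D) F (snd C p) = 0"
      using proper Cp by (auto simp: proper_biharmonic_def biharmonic_map_def F_def)
    show "contact_metric_space (metric N D (F (snd C p))) (xi N D (F (snd C p))) (eta N D (F (snd C p))) (phi N D (F (snd C p)))"
      by (rule contact[OF F_in_W[OF x]])
    show "xi N D (F (snd C p)) \<in> range (dF (snd C p))"
      using xi Cp F[OF p] by (auto simp: xi_tangent_def map_deriv_def F_def)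
    show "real CARD('n) * f1 (\<psi> p) - f2 (\<psi> p) + 3 * f3 (\<psi> p) \<le> 0"
    proof (rule le)
      have "openin (mfd_top N) (fst D)"
        using hyp D by (auto simp: hypersurface_def riemannian_manifold_def smooth_manifold_def)
      then show "\<psi> p \<in> topspace (mfd_top N)"
        using p(2) openin_subset by blast
    qed
    show "riem (metric N D) (F (snd C p)) X Y Z
      = f1 (\<psi> p) *\<^sub>R R1star (g (F (snd C p))) X Y Z
        + f2 (\<psi> p) *\<^sub>R R2star (g (F (snd C p))) (xi N D (F (snd C p))) (\<lambda>u. eta N D (F (snd C p)) \<bullet> u) X Y Z
        + f3 (\<psi> p) *\<^sub>R R3star (g (F (snd C p))) (\<lambda>u. phi N D (F (snd C p)) *v u) X Y Z" for X Y Z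
      using gssf D p(2) unfolding generalized_sasakian_space_form_def Let_def F[OF p] by blast
  qed
  then show False using nz by (simp add: F_def)
qed

text \<open>In dimension \<open>n + 1\<close> the number \<open>4 (n f\<^sub>1 - f\<^sub>2 + 3 f\<^sub>3)\<close> is \<open>(n + 2) c + 3 n - 2\<close> for a Sasakian,
  \<open>(n + 2) c - 3 n + 2\<close> for a Kenmotsu and \<open>(n + 2) c\<close> for a cosymplectic space form.\<close>

theorem corollary4p5:
  fixes N :: "('b, 'm::finite) contact_metric"
    and n :: real
  assumes dim: "CARD('m) = CARD('n::finite) + 1"
    and n_def: "n = real CARD('n)"
  shows "(\<forall>f1 f2 f3. generalized_sasakian_space_form N f1 f2 f3 \<and>
            (\<forall>q\<in>topspace (mfd_top N). n * f1 q - f2 q + 3 * f3 q \<le> 0) \<longrightarrow>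
          \<not> (\<exists>(M :: ('a, 'n) riemannian) \<psi>. hypersurface M N \<psi> \<and> xi_tangent M N \<psi> \<and>
                constant_mean_curvature M N \<psi> \<and> proper_biharmonic M N \<psi>))
       \<and> (\<forall>c. sasakian_space_form N c \<and> c \<le> - ((3 * n - 2) / (n + 2)) \<longrightarrow>
          \<not> (\<exists>(M :: ('a, 'n) riemannian) \<psi>. hypersurface M N \<psi> \<and> xi_tangent M N \<psi> \<and>
                constant_mean_curvature M N \<psi> \<and> proper_biharmonic M N \<psi>))
       \<and> (\<forall>c. kenmotsu_space_form N c \<and> c \<le> (3 * n - 2) / (n + 2) \<longrightarrow>
          \<not> (\<exists>(M :: ('a, 'n) riemannian) \<psi>. hypersurface M N \<psi> \<and> xi_tangent M N \<psi> \<and>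
                constant_mean_curvature M N \<psi> \<and> proper_biharmonic M N \<psi>))
       \<and> (\<forall>c. cosymplectic_space_form N c \<and> c \<le> 0 \<longrightarrow>
          \<not> (\<exists>(M :: ('a, 'n) riemannian) \<psi>. hypersurface M N \<psi> \<and> xi_tangent M N \<psi> \<and>
                constant_mean_curvature M N \<psi> \<and> proper_biharmonic M N \<psi>))"
    (is "?gssf \<and> ?sasakian \<and> ?kenmotsu \<and> ?cosymplectic")
proof -
  have n: "n \<ge> 0" by (simp add: n_def)
  have gssf: "\<not> (\<exists>(M :: ('a, 'n) riemannian) \<psi>. hypersurface M N \<psi> \<and> xi_tangent M N \<psi> \<and>
                constant_mean_curvature M N \<psi> \<and> proper_biharmonic M N \<psi>)"
    if "generalized_sasakian_space_form N f1 f2 f3"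
      "\<And>q. q \<in> topspace (mfd_top N) \<Longrightarrow> n * f1 q - f2 q + 3 * f3 q \<le> 0" for f1 f2 f3
    using no_proper_biharmonic_cmc_hypersurface[OF that(1) that(2)[unfolded n_def]] by blast
  have ?gssf using gssf by blast
  moreover have ?sasakian
  proof (intro allI impI, elim conjE)
    fix c assume N: "sasakian_space_form N c" and c: "c \<le> - ((3 * n - 2) / (n + 2))"
    have "c * (n + 2) \<le> - (3 * n - 2)"
      using c n by (simp add: field_simps)
    then have "n * ((c + 3) / 4) - (c - 1) / 4 + 3 * ((c - 1) / 4) \<le> 0"
      by (simp add: field_simps)
    with sasakian_space_form_curvature[OF N] show "\<not> (\<exists>(M :: ('a, 'n) riemannian) \<psi>.
        hypersurface M N \<psi> \<and> xi_tangent M N \<psi> \<and> constant_mean_curvature M N \<psi> \<and> proper_biharmonic M N \<psi>)"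
      by (rule gssf)
  qed
  moreover have ?kenmotsu
  proof (intro allI impI, elim conjE)
    fix c assume N: "kenmotsu_space_form N c" and c: "c \<le> (3 * n - 2) / (n + 2)"
    have "c * (n + 2) \<le> 3 * n - 2"
      using c n by (simp add: field_simps)
    then have "n * ((c - 3) / 4) - (c + 1) / 4 + 3 * ((c + 1) / 4) \<le> 0"
      by (simp add: field_simps)
    with kenmotsu_space_form_curvature[OF N] show "\<not> (\<exists>(M :: ('a, 'n) riemannian) \<psi>.
        hypersurface M N \<psi> \<and> xi_tangent M N \<psi> \<and> constant_mean_curvature M N \<psi> \<and> proper_biharmonic M N \<psi>)"
      by (rule gssf)
  qed
  moreover have ?cosymplectic
  proof (intro allI impI, elim conjE)
    fix c :: real assume N: "cosymplectic_space_form N c" and c: "c \<le> 0"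
    have "n * (c / 4) - c / 4 + 3 * (c / 4) \<le> 0"
      using mult_nonneg_nonpos[OF n c] c by (simp add: field_simps)
    with cosymplectic_space_form_curvature[OF N] show "\<not> (\<exists>(M :: ('a, 'n) riemannian) \<psi>.
        hypersurface M N \<psi> \<and> xi_tangent M N \<psi> \<and> constant_mean_curvature M N \<psi> \<and> proper_biharmonic M N \<psi>)"
      by (rule gssf)
  qed
  ultimately show ?thesis by blast
qed

end
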